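(* Let $n\ge 2$ and let $\Sigma=L_1\cup\cdots\cup L_n\subset\mathbb{C}^2$ be a union of $n$ distinct complex lines. Then $\Sigma$ is a union of parallel lines if and only if the fundamental group $\pi_1(\mathbb{C}^2\setminus\Sigma)$ is a free group.
   Context: A complex line in $\mathbb{C}^2$ is the solution set of a linear equation $ax+by+c=0$ with $a,b,c\in\mathbb{C}$ and $(a,b)\neq(0,0)$. $\Sigma$ is called a union of parallel lines if the lines $L_1,\dots,L_n$ all have the same slope (the same direction); equivalently, for distinct lines, they are pairwise disjoint. The fundamental group is that of the complement with its topology induced from $\mathbb{C}^2$ (the complement is path connected, so the base point is irrelevant). *)

theory Defs
  imports "HOL-Analysis.Analysis" "HOL-Algebra.Group"
begin

section \<open>The fundamental group\<close>

definition loops_at :: "'a::topological_space set \<Rightarrow> 'a \<Rightarrow> (real \<Rightarrow> 'a) set" where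
  "loops_at S a = {f. path f \<and> path_image f \<subseteq> S \<and> pathstart f = a \<and> pathfinish f = a}"

text \<open>Homotopy relative to the endpoints, within \<open>S\<close>. Paths are total functions on the reals, but
  only their values on \<open>{0..1}\<close> matter, so the class does not depend on the values elsewhere.\<close>

definition path_class :: "'a::topological_space set \<Rightarrow> (real \<Rightarrow> 'a) \<Rightarrow> (real \<Rightarrow> 'a) set" where
  "path_class S f = {g. homotopic_paths S f g}"

definition fundamental_group ::
    "'a::topological_space set \<Rightarrow> 'a \<Rightarrow> (real \<Rightarrow> 'a) set monoid" where
  "fundamental_group S a =
     \<lparr>carrier = path_class S ` loops_at S a,
      monoid.mult = (\<lambda>A B. \<Union>f\<in>A. \<Union>g\<in>B. path_class S (f +++ g)),
      one = path_class S (\<lambda>_. a)\<rparr>"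

lemma path_class_eqI: "homotopic_paths S f g \<Longrightarrow> path_class S f = path_class S g"
  unfolding path_class_def
  by (intro Collect_cong iffI) (erule homotopic_paths_trans[OF homotopic_paths_sym] homotopic_paths_trans, assumption)+

lemma path_class_eq_iff:
  assumes "f \<in> loops_at S a"
  shows "path_class S f = path_class S g \<longleftrightarrow> homotopic_paths S f g"
proof
  assume "path_class S f = path_class S g"
  moreover have "f \<in> path_class S f"
    using assms by (simp add: path_class_def loops_at_def)
  ultimately have "homotopic_paths S g f"
    by (simp add: path_class_def)
  then show "homotopic_paths S f g"
    by (rule homotopic_paths_sym)
qed (rule path_class_eqI)

lemma loops_at_join: "f \<in> loops_at S a \<Longrightarrow> g \<in> loops_at S a \<Longrightarrow> f +++ g \<in> loops_at S a"
  by (simp add: loops_at_def path_image_join)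

lemma loops_at_reverse: "f \<in> loops_at S a \<Longrightarrow> reversepath f \<in> loops_at S a"
  by (simp add: loops_at_def)

lemma loops_at_const: "a \<in> S \<Longrightarrow> (\<lambda>_. a) \<in> loops_at S a"
  by (auto simp: loops_at_def path_def path_image_def pathstart_def pathfinish_def)

lemma mult_path_class:
  assumes "f \<in> loops_at S a" "g \<in> loops_at S a"
  shows "path_class S f \<otimes>\<^bsub>fundamental_group S a\<^esub> path_class S g = path_class S (f +++ g)"
proof -
  have "path_class S (f' +++ g') = path_class S (f +++ g)"
    if "f' \<in> path_class S f" "g' \<in> path_class S g" for f' g'
  proof (rule path_class_eqI[symmetric], rule homotopic_paths_join)
    show "pathfinish f = pathstart g"
      using assms by (simp add: loops_at_def)
  qed (use that in \<open>auto simp: path_class_def\<close>)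
  moreover have "f \<in> path_class S f" "g \<in> path_class S g"
    using assms by (auto simp: path_class_def loops_at_def)
  ultimately have "(\<Union>f'\<in>path_class S f. \<Union>g'\<in>path_class S g. path_class S (f' +++ g')) = path_class S (f +++ g)"
    by blast
  then show ?thesis
    by (simp add: fundamental_group_def)
qed

lemma group_fundamental_group:
  fixes S :: "'a::real_normed_vector set"
  assumes "a \<in> S"
  shows "group (fundamental_group S a)"
proof -
  let ?G = "fundamental_group S a"
  have carrier: "carrier ?G = path_class S ` loops_at S a"
    and one: "\<one>\<^bsub>?G\<^esub> = path_class S (\<lambda>_. a)"
    by (simp_all add: fundamental_group_def)
  note c = loops_at_const[OF assms]
  show ?thesis
  proof (rule groupI)
    fix x y assume "x \<in> carrier ?G" "y \<in> carrier ?G"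
    then show "x \<otimes>\<^bsub>?G\<^esub> y \<in> carrier ?G"
      by (auto simp: carrier mult_path_class intro: loops_at_join)
  next
    show "\<one>\<^bsub>?G\<^esub> \<in> carrier ?G"
      using c by (simp add: carrier one)
  next
    fix x y z assume "x \<in> carrier ?G" "y \<in> carrier ?G" "z \<in> carrier ?G"
    then obtain f g h where "x = path_class S f" "y = path_class S g" "z = path_class S h"
      and l: "f \<in> loops_at S a" "g \<in> loops_at S a" "h \<in> loops_at S a"
      by (auto simp: carrier)
    moreover have "homotopic_paths S ((f +++ g) +++ h) (f +++ (g +++ h))"
      using l by (intro homotopic_paths_sym[OF homotopic_paths_assoc]) (auto simp: loops_at_def)
    ultimately show "x \<otimes>\<^bsub>?G\<^esub> y \<otimes>\<^bsub>?G\<^esub> z = x \<otimes>\<^bsub>?G\<^esub> (y \<otimes>\<^bsub>?G\<^esub> z)"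
      by (simp add: mult_path_class loops_at_join path_class_eqI)
  next
    fix x assume "x \<in> carrier ?G"
    then obtain f where x: "x = path_class S f" and f: "f \<in> loops_at S a"
      by (auto simp: carrier)
    have "homotopic_paths S ((\<lambda>_. a) +++ f) f"
      using f homotopic_paths_lid'[of f S a] by (simp add: loops_at_def linepath_refl)
    then show "\<one>\<^bsub>?G\<^esub> \<otimes>\<^bsub>?G\<^esub> x = x"
      using c f by (simp add: x one mult_path_class path_class_eqI)
    have "homotopic_paths S (reversepath f +++ f) (\<lambda>_. a)"
      using f homotopic_paths_linv[of f S] by (simp add: loops_at_def linepath_refl)
    then have "path_class S (reversepath f) \<otimes>\<^bsub>?G\<^esub> x = \<one>\<^bsub>?G\<^esub>"
      using f by (simp add: x one mult_path_class loops_at_reverse path_class_eqI)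
    then show "\<exists>y\<in>carrier ?G. y \<otimes>\<^bsub>?G\<^esub> x = \<one>\<^bsub>?G\<^esub>"
      using f by (auto simp: carrier intro!: bexI[of _ "reversepath f"] loops_at_reverse)
  qed
qed


section \<open>Free groups\<close>

text \<open>The letter \<open>(x, True)\<close> stands for the generator \<open>x\<close>, and \<open>(x, False)\<close> for its inverse.\<close>

type_synonym 'a letter = "'a \<times> bool"

definition inv_letter :: "'a letter \<Rightarrow> 'a letter" where
  "inv_letter l = (fst l, \<not> snd l)"

fun reduced_word :: "'a letter list \<Rightarrow> bool" where
  "reduced_word (k # l # w) \<longleftrightarrow> l \<noteq> inv_letter k \<and> reduced_word (l # w)"
| "reduced_word _ \<longleftrightarrow> True"

fun cons_letter :: "'a letter \<Rightarrow> 'a letter list \<Rightarrow> 'a letter list" where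
  "cons_letter k [] = [k]"
| "cons_letter k (l # w) = (if l = inv_letter k then w else k # l # w)"

text \<open>Concatenation followed by free reduction, where \<open>v\<close> is already reduced.\<close>

definition word_mult :: "'a letter list \<Rightarrow> 'a letter list \<Rightarrow> 'a letter list" where
  "word_mult u v = foldr cons_letter u v"

definition free_group :: "'a set \<Rightarrow> 'a letter list monoid" where
  "free_group X =
     \<lparr>carrier = {w. set w \<subseteq> X \<times> UNIV \<and> reduced_word w},
      monoid.mult = word_mult,
      one = []\<rparr>"

text \<open>Drawing the generators from the type of the elements of \<open>G\<close> is no restriction, because a basis of a
  free group can be taken to be a subset of its carrier. The empty \<open>X\<close> gives the trivial group.\<close>

definition is_free_group :: "('a, 'b) monoid_scheme \<Rightarrow> bool" where
  "is_free_group G \<longleftrightarrow> group G \<and> (\<exists>X :: 'a set. G \<cong> free_group X)"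

lemma inv_letter_inv_letter [simp]: "inv_letter (inv_letter l) = l"
  by (simp add: inv_letter_def)

lemma inv_letter_neq [simp]: "inv_letter l \<noteq> l"
  by (cases l) (simp add: inv_letter_def)

lemma reduced_tl: "reduced_word (k # w) \<Longrightarrow> reduced_word w"
  by (cases w) auto

lemma reduced_cons_letter: "reduced_word w \<Longrightarrow> reduced_word (cons_letter k w)"
  by (cases w) (auto dest: reduced_tl)

lemma cons_letter_reduced: "reduced_word (k # w) \<Longrightarrow> cons_letter k w = k # w"
  by (cases w) auto

lemma cons_letter_inv:
  assumes "reduced_word w"
  shows "cons_letter k (cons_letter (inv_letter k) w) = w"
proof (cases w)
  case (Cons l v)
  with assms show ?thesis
    by (cases v) auto
qed simp

lemma set_cons_letter: "set (cons_letter k w) \<subseteq> insert k (set w)"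
  by (cases w) auto

lemma reduced_word_mult: "reduced_word v \<Longrightarrow> reduced_word (word_mult u v)"
  unfolding word_mult_def by (induction u) (auto intro: reduced_cons_letter)

lemma set_word_mult: "set (word_mult u v) \<subseteq> set u \<union> set v"
  unfolding word_mult_def by (induction u) (use set_cons_letter in fastforce)+

lemma word_mult_cons_letter:
  assumes "reduced_word v"
  shows "word_mult (cons_letter k u) v = cons_letter k (word_mult u v)"
proof (cases u)
  case (Cons l w)
  have "cons_letter k (cons_letter (inv_letter k) (word_mult w v)) = word_mult w v"
    using assms by (intro cons_letter_inv reduced_word_mult)
  with Cons show ?thesis
    by (auto simp: word_mult_def)
qed (simp add: word_mult_def)

lemma word_mult_assoc:
  assumes "reduced_word w"
  shows "word_mult (word_mult u v) w = word_mult u (word_mult v w)"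
proof (induction u)
  case (Cons k u)
  have "word_mult (word_mult (k # u) v) w = cons_letter k (word_mult (word_mult u v) w)"
    using word_mult_cons_letter[OF assms] by (simp add: word_mult_def)
  with Cons show ?case
    by (simp add: word_mult_def)
qed (simp add: word_mult_def)

lemma word_mult_Nil_right: "reduced_word u \<Longrightarrow> word_mult u [] = u"
proof (induction u)
  case (Cons k u)
  then have "word_mult u [] = u"
    by (auto dest: reduced_tl)
  with Cons.prems show ?case
    using cons_letter_reduced by (simp add: word_mult_def)
qed (simp add: word_mult_def)

lemma word_mult_linv: "reduced_word u \<Longrightarrow> word_mult (rev (map inv_letter u)) u = []"
proof (induction u)
  case (Cons k u)
  then show ?case
    by (auto simp: word_mult_def dest: reduced_tl)
qed (simp add: word_mult_def)

lemma group_free_group: "group (free_group X)"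
proof -
  let ?F = "free_group X"
  have mem: "w \<in> carrier ?F \<longleftrightarrow> set w \<subseteq> X \<times> UNIV \<and> reduced_word w" for w
    by (simp add: free_group_def)
  have [simp]: "\<one>\<^bsub>?F\<^esub> = []" "u \<otimes>\<^bsub>?F\<^esub> v = word_mult u v" for u v
    by (simp_all add: free_group_def)
  show ?thesis
  proof (rule groupI)
    fix u v assume "u \<in> carrier ?F" "v \<in> carrier ?F"
    then show "u \<otimes>\<^bsub>?F\<^esub> v \<in> carrier ?F"
      using set_word_mult[of u v] by (auto simp: mem reduced_word_mult)
  next
    fix u assume u: "u \<in> carrier ?F"
    let ?w = "rev (map inv_letter u)"
    have "set ?w \<subseteq> X \<times> UNIV"
      using u by (fastforce simp: mem inv_letter_def)
    then have "set (word_mult ?w []) \<subseteq> X \<times> UNIV"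
      using set_word_mult[of ?w "[]"] by simp
    then have "word_mult ?w [] \<in> carrier ?F"
      by (simp add: mem reduced_word_mult)
    moreover have "word_mult (word_mult ?w []) u = []"
      using u word_mult_assoc[of u ?w "[]"] word_mult_linv[of u] by (simp add: mem) (simp add: word_mult_def)
    ultimately show "\<exists>v\<in>carrier ?F. v \<otimes>\<^bsub>?F\<^esub> u = \<one>\<^bsub>?F\<^esub>"
      by auto
  next
    fix u v w assume "u \<in> carrier ?F" "v \<in> carrier ?F" "w \<in> carrier ?F"
    then show "u \<otimes>\<^bsub>?F\<^esub> v \<otimes>\<^bsub>?F\<^esub> w = u \<otimes>\<^bsub>?F\<^esub> (v \<otimes>\<^bsub>?F\<^esub> w)"
      by (simp add: mem word_mult_assoc)
  qed (simp_all add: mem word_mult_def)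
qed


section \<open>Complex lines in the plane\<close>

definition complex_line :: "(complex \<times> complex) set \<Rightarrow> bool" where
  "complex_line L \<longleftrightarrow>
     (\<exists>a b c. (a, b) \<noteq> (0, 0) \<and> L = {(x, y). a * x + b * y + c = 0})"

text \<open>For a line, this is the linear subspace of which it is a translate; unlike a numerical slope it
  also covers the lines \<open>x = c\<close>.\<close>

definition direction :: "(complex \<times> complex) set \<Rightarrow> (complex \<times> complex) set" where
  "direction L = {u - v | u v. u \<in> L \<and> v \<in> L}"

definition parallel_lines :: "'i set \<Rightarrow> ('i \<Rightarrow> (complex \<times> complex) set) \<Rightarrow> bool" where
  "parallel_lines I L \<longleftrightarrow> (\<forall>i\<in>I. \<forall>j\<in>I. direction (L i) = direction (L j))"

lemma direction_line:
  assumes "(a, b) \<noteq> (0, 0)"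
  shows "direction {(x, y). a * x + b * y + c = 0} = {(x, y). a * x + b * y = 0}"
proof -
  obtain x0 y0 where *: "a * x0 + b * y0 + c = 0"
  proof (cases "a = 0")
    case True
    with assms have "a * 0 + b * (- c / b) + c = 0" by simp
    then show ?thesis by (rule that)
  next
    case False
    then have "a * (- c / a) + b * 0 + c = 0" by simp
    then show ?thesis by (rule that)
  qed
  show ?thesis
  proof (intro equalityI subsetI)
    fix w assume "w \<in> direction {(x, y). a * x + b * y + c = 0}"
    then obtain x y x' y' where w: "w = (x - x', y - y')"
      and eqs: "a * x + b * y + c = 0" "a * x' + b * y' + c = 0"
      by (auto simp: direction_def)
    have "a * (x - x') + b * (y - y') = (a * x + b * y + c) - (a * x' + b * y' + c)"
      by (simp add: algebra_simps)
    also have "\<dots> = 0"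
      by (simp only: eqs diff_self)
    finally show "w \<in> {(x, y). a * x + b * y = 0}"
      using w by simp
  next
    fix w assume "w \<in> {(x, y). a * x + b * y = 0}"
    then obtain x y where w: "w = (x, y)" "a * x + b * y = 0" by auto
    have "a * (x + x0) + b * (y + y0) + c = (a * x + b * y) + (a * x0 + b * y0 + c)"
      by (simp add: algebra_simps)
    then have "(x + x0, y + y0) \<in> {(x, y). a * x + b * y + c = 0}"
      "(x0, y0) \<in> {(x, y). a * x + b * y + c = 0}" "w = (x + x0, y + y0) - (x0, y0)"
      using * w by simp_all
    then show "w \<in> direction {(x, y). a * x + b * y + c = 0}"
      unfolding direction_def by blast
  qed
qed

end

(* If the lines are parallel, they are the fibres over finitely many points of a linear map to the
   complex plane, which after a rotation have distinct real parts. Removing the downward, or the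
   upward, ray from each of these points leaves two contractible open sets that cover the complement
   of the lines, and van Kampen's theorem makes the fundamental group free on all but one of the
   components of their intersection. To detect that the generators are free, loops are lifted to the
   covering whose sheets are labelled by the free group.

   If two of the lines cross, then a small torus around the crossing point avoids all lines. Its two
   circles commute, while their winding numbers around the two lines form the identity matrix. In a
   free group this is impossible: a pair of homomorphisms to an abelian group lifts to the Heisenberg
   group, so their determinant vanishes on commuting elements. *)

theory Submission
  imports Defs "HOL-Complex_Analysis.Winding_Numbers"
begin

section \<open>Free groups\<close>

text \<open>Homology cannot separate the two cases: the first homology group of the complement is
  free abelian of rank n for every arrangement of n lines. The obstruction has to see a commutator,
  which is why maps to a group that is nilpotent of class two are used. The familiar form of van
  Kampen's theorem has a connected intersection. Here both pieces are simply connected and the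
  intersection is disconnected, so every essential loop comes from passing between its components.
  The covering that detects these loops is never built as a space: only the labels of its sheets
  along a path appear, and continuity becomes local constancy in one of two trivializations.
  Compactness of the interval and of the square enters through bisection (\<open>Bolzano\<close>).
  \<open>is_free_group\<close> does not ask for the rank, so the components are never counted. It
  does fix the type of the generators, which forces a change of basis set at the end.\<close>

lemma carrier_free_group: "w \<in> carrier (free_group X) \<longleftrightarrow> set w \<subseteq> X \<times> UNIV \<and> reduced_word w"
  and mult_free_group [simp]: "u \<otimes>\<^bsub>free_group X\<^esub> v = word_mult u v"
  and one_free_group [simp]: "\<one>\<^bsub>free_group X\<^esub> = []"
  by (simp_all add: free_group_def)

section \<open>Homomorphisms from a free group and commuting elements\<close>

definition letter_value :: "('a \<Rightarrow> 'b::comm_ring_1) \<Rightarrow> 'a letter \<Rightarrow> 'b" where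
  "letter_value f l = (if snd l then f (fst l) else - f (fst l))"

definition word_value :: "('a \<Rightarrow> 'b::comm_ring_1) \<Rightarrow> 'a letter list \<Rightarrow> 'b" where
  "word_value f w = sum_list (map (letter_value f) w)"

lemma letter_value_inv: "letter_value f (inv_letter l) = - letter_value f l"
  by (simp add: letter_value_def inv_letter_def)

lemma word_value_cons_letter: "word_value f (cons_letter k w) = letter_value f k + word_value f w"
  by (cases w) (auto simp: word_value_def letter_value_inv)

lemma word_value_word_mult: "word_value f (word_mult u v) = word_value f u + word_value f v"
  by (induction u) (simp_all add: word_mult_def word_value_cons_letter, simp_all add: word_value_def)

text \<open>The corner entry of a homomorphism to the Heisenberg group whose superdiagonal entries are
  \<open>word_value f\<close> and \<open>word_value g\<close>; such a homomorphism exists because the source is free.\<close>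

fun heisenberg_entry :: "('a \<Rightarrow> 'b::comm_ring_1) \<Rightarrow> ('a \<Rightarrow> 'b) \<Rightarrow> 'a letter list \<Rightarrow> 'b" where
  "heisenberg_entry f g [] = 0"
| "heisenberg_entry f g (k # w) =
     (if snd k then 0 else f (fst k) * g (fst k)) + letter_value f k * word_value g w + heisenberg_entry f g w"

text \<open>A generator goes to a unitriangular matrix with corner 0. The inverse of that matrix has
  corner \<open>f x * g x\<close>, the extra term for letters marked \<open>False\<close>. With it
  the contributions of a cancelling pair sum to zero, so free reduction leaves the entry
  unchanged.\<close>

lemma heisenberg_entry_cons_letter:
  "heisenberg_entry f g (cons_letter k w) = heisenberg_entry f g (k # w)"
proof (cases w)
  case (Cons l v)
  then show ?thesis
    by (cases k) (auto simp: word_value_def letter_value_def inv_letter_def algebra_simps)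
qed simp

lemma heisenberg_entry_word_mult:
  "heisenberg_entry f g (word_mult u v) =
     heisenberg_entry f g u + heisenberg_entry f g v + word_value f u * word_value g v"
proof (induction u)
  case (Cons k u)
  have "word_value g (foldr cons_letter u v) = word_value g u + word_value g v"
    using word_value_word_mult[of g u v] by (simp add: word_mult_def)
  with Cons show ?case
    by (simp add: word_mult_def heisenberg_entry_cons_letter)
       (simp add: word_value_def algebra_simps)
qed (simp add: word_mult_def word_value_def)

text \<open>The product rule for the corner entries of the two products differs only in the cross
  terms, so these must agree.\<close>

lemma word_value_commute:
  assumes "word_mult u v = word_mult v u"
  shows "word_value f u * word_value g v = word_value f v * word_value g u"
  using heisenberg_entry_word_mult[of f g u v] heisenberg_entry_word_mult[of f g v u] assms
  by (simp add: algebra_simps)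

lemma additive_eq_word_value:
  assumes add: "\<And>u v. u \<in> carrier (free_group X) \<Longrightarrow> v \<in> carrier (free_group X) \<Longrightarrow>
      \<phi> (word_mult u v) = \<phi> u + \<phi> v"
    and "w \<in> carrier (free_group X)"
  shows "\<phi> w = word_value (\<lambda>x. \<phi> [(x, True)]) w"
  using assms(2)
proof (induction w)
  case Nil
  have "\<phi> (word_mult [] []) = \<phi> [] + \<phi> []"
    using add Nil by blast
  then show ?case
    by (simp add: word_mult_def word_value_def)
next
  case (Cons k w)
  obtain x s where k: "k = (x, s)"
    by (cases k)
  have x: "x \<in> X" and w: "w \<in> carrier (free_group X)" and r: "reduced_word (k # w)"
    using Cons.prems k by (auto simp: carrier_free_group dest: reduced_tl)
  have l: "[(x, b)] \<in> carrier (free_group X)" for b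
    using x by (simp add: carrier_free_group)
  have nil: "[] \<in> carrier (free_group X)"
    by (simp add: carrier_free_group)
  have "\<phi> [] = 0"
    using add[OF nil nil] by (simp add: word_mult_def)
  \<comment> \<open>The product is the empty word, whose value is 0, so this fixes the value of an
    inverse letter.\<close>
  moreover have "\<phi> (word_mult [(x, True)] [(x, False)]) = \<phi> [(x, True)] + \<phi> [(x, False)]"
    using add l by blast
  ultimately have "\<phi> [(x, False)] = - \<phi> [(x, True)]"
    by (simp add: word_mult_def inv_letter_def eq_neg_iff_add_eq_0 add.commute)
  then have "\<phi> [k] = letter_value (\<lambda>x. \<phi> [(x, True)]) k"
    using k by (cases s) (simp_all add: letter_value_def)
  moreover have "word_mult [k] w = k # w"
    using cons_letter_reduced[OF r] by (simp add: word_mult_def)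
  then have "\<phi> (k # w) = \<phi> [k] + \<phi> w"
    using add[of "[k]" w] l w k by auto
  ultimately show ?case
    using Cons.IH[OF w] by (simp add: word_value_def)
qed

text \<open>Along the isomorphism every additive map becomes a \<open>word_value\<close>, so
  \<open>word_value_commute\<close> applies. Winding numbers on a torus will contradict the
  conclusion.\<close>

lemma free_group_commute_det:
  fixes \<phi> \<psi> :: "'a \<Rightarrow> 'c::comm_ring_1"
  assumes "is_free_group G" and u: "u \<in> carrier G" and v: "v \<in> carrier G"
    and comm: "u \<otimes>\<^bsub>G\<^esub> v = v \<otimes>\<^bsub>G\<^esub> u"
    and \<phi>: "\<And>x y. x \<in> carrier G \<Longrightarrow> y \<in> carrier G \<Longrightarrow> \<phi> (x \<otimes>\<^bsub>G\<^esub> y) = \<phi> x + \<phi> y"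
    and \<psi>: "\<And>x y. x \<in> carrier G \<Longrightarrow> y \<in> carrier G \<Longrightarrow> \<psi> (x \<otimes>\<^bsub>G\<^esub> y) = \<psi> x + \<psi> y"
  shows "\<phi> u * \<psi> v = \<phi> v * \<psi> u"
proof -
  obtain X :: "'a set" where "group G" "G \<cong> free_group X"
    using assms(1) by (auto simp: is_free_group_def)
  then have "free_group X \<cong> G"
    by (simp add: group.iso_sym)
  then obtain h where h: "h \<in> iso (free_group X) G"
    by (auto simp: is_iso_def)
  let ?F = "free_group X"
  have hom: "h w \<in> carrier G" "h (word_mult w w') = h w \<otimes>\<^bsub>G\<^esub> h w'"
    if "w \<in> carrier ?F" "w' \<in> carrier ?F" for w w'
    using h that hom_mult[of h ?F G] hom_in_carrier[of h ?F G] by (auto simp: iso_def)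
  have "h ` carrier ?F = carrier G"
    using h by (simp add: iso_def bij_betw_def)
  then have surj: "\<exists>w\<in>carrier ?F. h w = x" if "x \<in> carrier G" for x
    using that by (metis imageE)
  obtain u' v' where u': "u' \<in> carrier ?F" "h u' = u" and v': "v' \<in> carrier ?F" "h v' = v"
    using surj u v by metis
  have "word_mult u' v' \<in> carrier ?F" "word_mult v' u' \<in> carrier ?F"
    using u' v' group.is_monoid[OF group_free_group[of X]] monoid.m_closed[of ?F]
    by fastforce+
  moreover have "h (word_mult u' v') = h (word_mult v' u')"
    using hom u' v' comm by simp
  ultimately have c: "word_mult u' v' = word_mult v' u'"
    using h by (auto simp: iso_def bij_betw_def dest: inj_onD)
  have val: "\<theta> (h w) = word_value (\<lambda>x. \<theta> (h [(x, True)])) w"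
    if "w \<in> carrier ?F" "\<And>x y. x \<in> carrier G \<Longrightarrow> y \<in> carrier G \<Longrightarrow> \<theta> (x \<otimes>\<^bsub>G\<^esub> y) = \<theta> x + \<theta> y"
    for \<theta> :: "'a \<Rightarrow> 'c" and w
    using additive_eq_word_value[of X "\<lambda>w. \<theta> (h w)" w] that hom by simp
  have "\<phi> (h u') = word_value (\<lambda>x. \<phi> (h [(x, True)])) u'"
    "\<phi> (h v') = word_value (\<lambda>x. \<phi> (h [(x, True)])) v'"
    "\<psi> (h u') = word_value (\<lambda>x. \<psi> (h [(x, True)])) u'"
    "\<psi> (h v') = word_value (\<lambda>x. \<psi> (h [(x, True)])) v'"
    by (rule val; use u'(1) v'(1) \<phi> \<psi> in blast)+
  then show ?thesis
    using u'(2) v'(2) word_value_commute[OF c] by simp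
qed

text \<open>\<open>is_free_group\<close> takes generators from the element type of the group, so a
  basis found in another type has to be renamed injectively.\<close>

lemma free_group_map_iso:
  assumes "inj_on f X"
  shows "map (map_prod f id) \<in> iso (free_group X) (free_group (f ` X))"
proof -
  let ?m = "map (map_prod f id) :: ('a \<times> bool) list \<Rightarrow> ('b \<times> bool) list"
  have inv: "map_prod f id l = inv_letter (map_prod f id k) \<longleftrightarrow> l = inv_letter k"
    if "l \<in> X \<times> UNIV" "k \<in> X \<times> UNIV" for k l
    using that assms by (cases k; cases l) (auto simp: inv_letter_def inj_on_def)
  have red: "reduced_word (?m w) \<longleftrightarrow> reduced_word w" if "set w \<subseteq> X \<times> UNIV" for w
    using that by (induction w rule: reduced_word.induct) (simp_all add: inv)
  have cons: "?m (cons_letter k w) = cons_letter (map_prod f id k) (?m w)"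
    if "set (k # w) \<subseteq> X \<times> UNIV" for k w
    using that by (cases w) (simp_all add: inv)
  have mult: "?m (word_mult u v) = word_mult (?m u) (?m v)"
    if "set u \<subseteq> X \<times> UNIV" "set v \<subseteq> X \<times> UNIV" for u v
    using that
  proof (induction u)
    case (Cons k u)
    have "set (k # word_mult u v) \<subseteq> X \<times> UNIV"
      using Cons.prems set_word_mult[of u v] by auto
    then have "?m (cons_letter k (word_mult u v)) = cons_letter (map_prod f id k) (?m (word_mult u v))"
      by (rule cons)
    with Cons show ?case
      by (simp add: word_mult_def id_def)
  qed (simp add: word_mult_def)
  have inj: "inj_on (map_prod f id) (X \<times> (UNIV :: bool set))"
    using assms by (auto simp: inj_on_def)
  have "inj_on ?m (carrier (free_group X))"
    by (intro inj_on_mapI inj_on_subset[OF inj]) (auto simp: carrier_free_group)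
  moreover have "?m ` carrier (free_group X) = carrier (free_group (f ` X))"
  proof (intro equalityI subsetI)
    fix w assume "w \<in> ?m ` carrier (free_group X)"
    then show "w \<in> carrier (free_group (f ` X))"
      by (fastforce simp: carrier_free_group red)
  next
    fix w assume w: "w \<in> carrier (free_group (f ` X))"
    have "map_prod f id ` (X \<times> UNIV) = f ` X \<times> (UNIV :: bool set)"
      by force
    then have "w \<in> lists (map_prod f id ` (X \<times> UNIV))"
      using w by (auto simp: carrier_free_group lists_eq_set)
    then obtain v where "v \<in> lists (X \<times> UNIV)" "w = ?m v"
      unfolding lists_image by blast
    then have "set v \<subseteq> X \<times> UNIV" "w = ?m v"
      by (auto simp: lists_eq_set)
    then show "w \<in> ?m ` carrier (free_group X)"
      using w red by (auto simp: carrier_free_group)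
  qed
  ultimately show ?thesis
    using mult by (auto simp: iso_def hom_def bij_betw_def carrier_free_group)
qed

lemma is_free_group_iso:
  fixes G :: "('a, 'b) monoid_scheme" and H :: "('a, 'c) monoid_scheme"
  assumes "is_free_group G" "group H" "G \<cong> H"
  shows "is_free_group H"
proof -
  have "group G"
    using assms(1) by (simp add: is_free_group_def)
  then show ?thesis
    using assms group.iso_sym[of G H] iso_trans[of H G] by (auto simp: is_free_group_def)
qed

section \<open>Evaluating words in a group and recognising a free basis\<close>

context group
begin

definition eval_letter :: "('x \<Rightarrow> 'a) \<Rightarrow> 'x letter \<Rightarrow> 'a" where
  "eval_letter e l = (if snd l then e (fst l) else inv (e (fst l)))"

definition eval_word :: "('x \<Rightarrow> 'a) \<Rightarrow> 'x letter list \<Rightarrow> 'a" where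
  "eval_word e w = foldr (\<lambda>k g. eval_letter e k \<otimes> g) w \<one>"

context
  fixes e :: "'x \<Rightarrow> 'a"
  assumes e: "\<And>x. e x \<in> carrier G"
begin

lemma eval_letter_closed: "eval_letter e l \<in> carrier G"
  by (simp add: eval_letter_def e)

lemma eval_word_Nil: "eval_word e [] = \<one>"
  and eval_word_Cons: "eval_word e (k # w) = eval_letter e k \<otimes> eval_word e w"
  by (simp_all add: eval_word_def)

lemma eval_word_closed: "eval_word e w \<in> carrier G"
  by (induction w) (simp_all add: eval_word_Nil eval_word_Cons eval_letter_closed)

lemma eval_letter_inv: "eval_letter e (inv_letter l) = inv (eval_letter e l)"
  by (simp add: eval_letter_def inv_letter_def e)

lemma eval_word_cons_letter: "eval_word e (cons_letter k w) = eval_letter e k \<otimes> eval_word e w"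
  by (cases w)
     (simp_all add: eval_word_Nil eval_word_Cons eval_letter_inv eval_letter_closed eval_word_closed
        m_assoc[symmetric])

lemma eval_word_mult: "eval_word e (word_mult u v) = eval_word e u \<otimes> eval_word e v"
proof (induction u)
  case (Cons k u)
  then show ?case
    using eval_word_cons_letter[of k "word_mult u v"]
    by (simp add: word_mult_def eval_word_Cons eval_letter_closed eval_word_closed m_assoc)
qed (simp add: word_mult_def eval_word_Nil eval_word_closed)

text \<open>\<open>eval_word e\<close> is the inverse: \<open>ev\<close> gives one composite, and
  the other holds on letters by \<open>gen\<close>, hence on all reduced words. The homomorphism out
  of \<open>G\<close> certifies that the elements \<open>e x\<close> satisfy no relation, and
  \<open>ev\<close> that they generate.\<close>

lemma iso_free_groupI:
  assumes hom: "\<Psi> \<in> hom G (free_group X)"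
    and gen: "\<And>x. x \<in> X \<Longrightarrow> \<Psi> (e x) = [(x, True)]"
    and ev: "\<And>g. g \<in> carrier G \<Longrightarrow> eval_word e (\<Psi> g) = g"
  shows "\<Psi> \<in> iso G (free_group X)"
proof -
  interpret F: group "free_group X"
    by (rule group_free_group)
  interpret \<Psi>: group_hom G "free_group X" \<Psi>
    using hom by unfold_locales
  have letter: "\<Psi> (eval_letter e k) = [k]" if k: "k \<in> X \<times> UNIV" for k
  proof -
    obtain x s where [simp]: "k = (x, s)"
      by (cases k)
    have x: "x \<in> X"
      using k by simp
    have "inv\<^bsub>free_group X\<^esub> [(x, True)] = [(x, False)]"
      using x by (intro F.inv_equality) (auto simp: carrier_free_group word_mult_def inv_letter_def)
    then show ?thesis
      using x by (cases s) (simp_all add: eval_letter_def gen e)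
  qed
  have surj: "\<Psi> (eval_word e w) = w" if "w \<in> carrier (free_group X)" for w
    using that
  proof (induction w)
    case Nil
    then show ?case
      using \<Psi>.hom_one by (simp add: eval_word_Nil)
  next
    case (Cons k w)
    then have k: "k \<in> X \<times> UNIV" and w: "w \<in> carrier (free_group X)" and r: "reduced_word (k # w)"
      by (auto simp: carrier_free_group dest: reduced_tl)
    have "\<Psi> (eval_word e (k # w)) = word_mult [k] w"
      using Cons.IH[OF w] \<Psi>.hom_mult[OF eval_letter_closed eval_word_closed] letter[OF k]
      by (simp add: eval_word_Cons)
    then show ?case
      using cons_letter_reduced[OF r] by (simp add: word_mult_def)
  qed
  have "bij_betw \<Psi> (carrier G) (carrier (free_group X))"
    by (rule bij_betw_byWitness[of _ "eval_word e"])
       (use ev surj eval_word_closed hom in \<open>auto simp: hom_def\<close>)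
  with hom show ?thesis
    by (simp add: iso_def)
qed

end

end


section \<open>Change of base point\<close>

lemma homotopic_paths_cancel_left:
  fixes S :: "'a::real_normed_vector set"
  assumes "path g" "path_image g \<subseteq> S" "path f" "path_image f \<subseteq> S" "pathfinish g = pathstart f"
  shows "homotopic_paths S (reversepath g +++ (g +++ f)) f"
proof -
  note [trans] = homotopic_paths_trans
  have "homotopic_paths S (reversepath g +++ (g +++ f)) ((reversepath g +++ g) +++ f)"
    using assms by (intro homotopic_paths_assoc) simp_all
  also have "homotopic_paths S \<dots> (linepath (pathfinish g) (pathfinish g) +++ f)"
    using assms by (intro homotopic_paths_join homotopic_paths_linv) simp_all
  also have "homotopic_paths S \<dots> f"
    using assms by (intro homotopic_paths_lid') simp_all
  finally show ?thesis .
qed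

lemma homotopic_paths_cancel_right:
  fixes S :: "'a::real_normed_vector set"
  assumes "path g" "path_image g \<subseteq> S" "path f" "path_image f \<subseteq> S" "pathfinish f = pathstart g"
  shows "homotopic_paths S ((f +++ g) +++ reversepath g) f"
proof -
  note [trans] = homotopic_paths_trans
  have "homotopic_paths S ((f +++ g) +++ reversepath g) (f +++ (g +++ reversepath g))"
    using assms by (intro homotopic_paths_sym[OF homotopic_paths_assoc]) simp_all
  also have "homotopic_paths S \<dots> (f +++ linepath (pathstart g) (pathstart g))"
    using assms by (intro homotopic_paths_join homotopic_paths_rinv) simp_all
  also have "homotopic_paths S \<dots> f"
    using assms by (intro homotopic_paths_rid') simp_all
  finally show ?thesis .
qed

text \<open>The three connecting paths may differ because the van Kampen argument closes up paths
  between arbitrary points; for the change of base point they coincide.\<close>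

lemma homotopic_paths_conj_join:
  fixes S :: "'a::real_normed_vector set"
  assumes g: "path g" "path_image g \<subseteq> S" and h: "path h" "path_image h \<subseteq> S"
    and k: "path k" "path_image k \<subseteq> S"
    and f: "path f" "path_image f \<subseteq> S" "pathstart f = pathfinish g" "pathfinish f = pathfinish h"
    and f': "path f'" "path_image f' \<subseteq> S" "pathstart f' = pathfinish h" "pathfinish f' = pathfinish k"
  shows "homotopic_paths S ((g +++ (f +++ reversepath h)) +++ (h +++ (f' +++ reversepath k)))
           (g +++ ((f +++ f') +++ reversepath k))"
proof -
  note [trans] = homotopic_paths_trans
  note [simp] = g h k f f'
  let ?r = "f' +++ reversepath k"
  have "homotopic_paths S ((g +++ (f +++ reversepath h)) +++ (h +++ ?r))
          (g +++ ((f +++ reversepath h) +++ (h +++ ?r)))"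
    by (intro homotopic_paths_sym[OF homotopic_paths_assoc]) (simp_all add: subset_path_image_join)
  also have "homotopic_paths S \<dots> (g +++ (f +++ (reversepath h +++ (h +++ ?r))))"
    by (intro homotopic_paths_join homotopic_paths_sym[OF homotopic_paths_assoc])
       (simp_all add: subset_path_image_join)
  also have "homotopic_paths S \<dots> (g +++ (f +++ ?r))"
    by (intro homotopic_paths_join homotopic_paths_cancel_left) (simp_all add: subset_path_image_join)
  also have "homotopic_paths S \<dots> (g +++ ((f +++ f') +++ reversepath k))"
    by (intro homotopic_paths_join homotopic_paths_assoc) (simp_all add: subset_path_image_join)
  finally show ?thesis .
qed

text \<open>Applied to a path and to its reverse, so that conjugation by each undoes conjugation by
  the other.\<close>

lemma homotopic_paths_conj_conj:
  fixes S :: "'a::real_normed_vector set"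
  assumes g: "path g" "path_image g \<subseteq> S"
    and f: "path f" "path_image f \<subseteq> S" "pathstart f = pathfinish g" "pathfinish f = pathfinish g"
  shows "homotopic_paths S (reversepath g +++ ((g +++ (f +++ reversepath g)) +++ reversepath (reversepath g))) f"
proof -
  note [trans] = homotopic_paths_trans
  note [simp] = g f
  have "homotopic_paths S (reversepath g +++ ((g +++ (f +++ reversepath g)) +++ reversepath (reversepath g)))
      (reversepath g +++ (g +++ ((f +++ reversepath g) +++ reversepath (reversepath g))))"
    by (intro homotopic_paths_join homotopic_paths_sym[OF homotopic_paths_assoc])
       (simp_all add: subset_path_image_join)
  also have "homotopic_paths S \<dots> ((f +++ reversepath g) +++ reversepath (reversepath g))"
    by (intro homotopic_paths_cancel_left) (simp_all add: subset_path_image_join)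
  also have "homotopic_paths S \<dots> f"
    by (intro homotopic_paths_cancel_right) simp_all
  finally show ?thesis .
qed

lemma homotopic_paths_conj:
  assumes "homotopic_paths S f f'" "path g" "path_image g \<subseteq> S" "pathstart f = pathfinish g"
    and "path h" "path_image h \<subseteq> S" "pathfinish f = pathfinish h"
  shows "homotopic_paths S (g +++ (f +++ reversepath h)) (g +++ (f' +++ reversepath h))"
  using assms by (intro homotopic_paths_join) simp_all

lemma carrier_fundamental_group: "carrier (fundamental_group S a) = path_class S ` loops_at S a"
  by (simp add: fundamental_group_def)

text \<open>Maps on homotopy classes are defined below through a representative picked by
  \<open>SOME\<close>; this compares the pick with a given loop.\<close>

lemma path_class_some:
  assumes "f \<in> loops_at S a"
  shows "homotopic_paths S f (SOME g. g \<in> path_class S f)"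
proof -
  have "f \<in> path_class S f"
    using assms by (simp add: path_class_def loops_at_def)
  then have "(SOME g. g \<in> path_class S f) \<in> path_class S f"
    by (rule someI[of "\<lambda>g. g \<in> path_class S f"])
  then show ?thesis
    by (simp add: path_class_def)
qed

lemma fundamental_group_basepoint_iso:
  fixes S :: "'a::real_normed_vector set"
  assumes g: "path g" "path_image g \<subseteq> S" "pathstart g = b" "pathfinish g = a"
  shows "fundamental_group S a \<cong> fundamental_group S b"
proof -
  define c where "c k f = k +++ (f +++ reversepath k)" for k f :: "real \<Rightarrow> 'a"
  define \<Phi> where "\<Phi> k A = path_class S (c k (SOME f. f \<in> A))" for k A
  have c_loop: "c k f \<in> loops_at S y"
    if "f \<in> loops_at S x" "path k" "path_image k \<subseteq> S" "pathstart k = y" "pathfinish k = x" for k f x y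
    using that by (simp add: c_def loops_at_def subset_path_image_join)
  have \<Phi>: "\<Phi> k (path_class S f) = path_class S (c k f)"
    if "f \<in> loops_at S x" "path k" "path_image k \<subseteq> S" "pathfinish k = x" for k f x
    unfolding \<Phi>_def c_def
    by (intro path_class_eqI homotopic_paths_conj homotopic_paths_sym[OF path_class_some])
       (use that path_class_some[OF that(1)] in
         \<open>auto simp: loops_at_def dest: homotopic_paths_imp_pathstart homotopic_paths_imp_pathfinish\<close>)
  let ?r = "reversepath g"
  note r = g path_reversepath[of g] path_image_reversepath[of g] pathstart_reversepath[of g] pathfinish_reversepath[of g]
  have "\<Phi> g \<in> hom (fundamental_group S a) (fundamental_group S b)"
  proof (rule homI)
    fix A assume "A \<in> carrier (fundamental_group S a)"
    then show "\<Phi> g A \<in> carrier (fundamental_group S b)"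
      using g \<Phi>[of _ a g] c_loop[of _ a g b] by (auto simp: carrier_fundamental_group)
  next
    fix A B assume "A \<in> carrier (fundamental_group S a)" "B \<in> carrier (fundamental_group S a)"
    then obtain f f' where f: "A = path_class S f" "f \<in> loops_at S a" "B = path_class S f'" "f' \<in> loops_at S a"
      by (auto simp: carrier_fundamental_group)
    have "homotopic_paths S (c g f +++ c g f') (c g (f +++ f'))"
      unfolding c_def using f g by (intro homotopic_paths_conj_join) (simp_all add: loops_at_def)
    then show "\<Phi> g (A \<otimes>\<^bsub>fundamental_group S a\<^esub> B) = \<Phi> g A \<otimes>\<^bsub>fundamental_group S b\<^esub> \<Phi> g B"
      using f g \<Phi>[of _ a g] c_loop[of _ a g b]
      by (simp add: mult_path_class loops_at_join path_class_eqI)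
  qed
  moreover have "bij_betw (\<Phi> g) (carrier (fundamental_group S a)) (carrier (fundamental_group S b))"
  proof (rule bij_betw_byWitness[of _ "\<Phi> ?r"])
    have "\<Phi> ?r (\<Phi> g (path_class S f)) = path_class S f" if f: "f \<in> loops_at S a" for f
    proof -
      have "c g f \<in> loops_at S b"
        using c_loop f g by blast
      then have "\<Phi> ?r (\<Phi> g (path_class S f)) = path_class S (c ?r (c g f))"
        using f r \<Phi>[of f a g] \<Phi>[of "c g f" b ?r] by simp
      also have "\<dots> = path_class S f"
        unfolding c_def using f g
        by (intro path_class_eqI homotopic_paths_conj_conj) (simp_all add: loops_at_def)
      finally show ?thesis .
    qed
    then show "\<forall>A\<in>carrier (fundamental_group S a). \<Phi> ?r (\<Phi> g A) = A"
      by (auto simp: carrier_fundamental_group)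
    have "\<Phi> g (\<Phi> ?r (path_class S f)) = path_class S f" if f: "f \<in> loops_at S b" for f
    proof -
      have "c ?r f \<in> loops_at S a"
        using c_loop[OF f, of ?r a] r by simp
      then have "\<Phi> g (\<Phi> ?r (path_class S f)) = path_class S (c g (c ?r f))"
        using f r \<Phi>[of f b ?r] \<Phi>[of "c ?r f" a g] by simp
      also have "\<dots> = path_class S f"
        using f r homotopic_paths_conj_conj[of ?r S f]
        by (intro path_class_eqI) (simp add: c_def loops_at_def)
      finally show ?thesis .
    qed
    then show "\<forall>A\<in>carrier (fundamental_group S b). \<Phi> g (\<Phi> ?r A) = A"
      by (auto simp: carrier_fundamental_group)
    show "\<Phi> g ` carrier (fundamental_group S a) \<subseteq> carrier (fundamental_group S b)"
      using r \<Phi>[of _ a g] c_loop[of _ a g b] by (auto simp: carrier_fundamental_group)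
    show "\<Phi> ?r ` carrier (fundamental_group S b) \<subseteq> carrier (fundamental_group S a)"
      using r \<Phi>[of _ b ?r] c_loop[of _ b ?r a] by (auto simp: carrier_fundamental_group)
  qed
  ultimately show ?thesis
    by (intro is_isoI[of "\<Phi> g"]) (simp add: iso_def)
qed

lemma is_free_group_basepoint:
  fixes S :: "'a::real_normed_vector set"
  assumes "path_connected S" "a \<in> S" "b \<in> S" "is_free_group (fundamental_group S a)"
  shows "is_free_group (fundamental_group S b)"
proof -
  obtain g where "path g" "path_image g \<subseteq> S" "pathstart g = b" "pathfinish g = a"
    using assms(1-3) unfolding path_connected_def by blast
  then show ?thesis
    by (intro is_free_group_iso[OF assms(4) group_fundamental_group[OF assms(3)]] fundamental_group_basepoint_iso)
qed


section \<open>Lifts with values in a group\<close>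

text \<open>The filter \<open>at\<close> ignores the point itself, but \<open>\<phi>\<close> may
  send points near \<open>t\<close> to \<open>\<phi> t\<close>; the assumption
  \<open>P (\<phi> t)\<close> covers these.\<close>

lemma eventually_at_within_compose:
  assumes "eventually P (at (\<phi> t) within K)" "P (\<phi> t)" "continuous_on K' \<phi>" "\<phi> ` K' \<subseteq> K" "t \<in> K'"
  shows "\<forall>\<^sub>F t' in at t within K'. P (\<phi> t')"
proof -
  obtain T where T: "open T" "\<phi> t \<in> T" "\<And>x. x \<in> T \<Longrightarrow> x \<in> K \<Longrightarrow> P x"
    using assms(1,2) unfolding eventually_at_topological by metis
  have "(\<phi> \<longlongrightarrow> \<phi> t) (at t within K')"
    using assms(3,5) by (simp add: continuous_on_def)
  then have "\<forall>\<^sub>F t' in at t within K'. \<phi> t' \<in> T"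
    using T by (blast dest: topological_tendstoD)
  moreover have "\<forall>\<^sub>F t' in at t within K'. t' \<in> K'"
    by (simp add: eventually_at_filter)
  ultimately show ?thesis
    by eventually_elim (use T assms(4) in blast)
qed

text \<open>The group \<open>F\<close> labels the sheets of a covering of \<open>U \<union> V\<close> that is trivial over \<open>U\<close> and over
  \<open>V\<close>, with \<open>\<kappa>\<close> as transition function. A lift of \<open>h\<close> records the label of a sheet in the
  trivialization over \<open>U\<close>, and, outside \<open>U\<close>, in that over \<open>V\<close>.\<close>

locale sheet_labels = group F for F :: "('f, 'm) monoid_scheme" (structure) +
  fixes U V :: "'a::topological_space set" and \<kappa> :: "'a \<Rightarrow> 'f"
  assumes U: "open U" and V: "open V"
    and \<kappa>_closed [simp, intro]: "\<kappa> x \<in> carrier F"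
    and \<kappa>_locally: "x \<in> U \<inter> V \<Longrightarrow> \<forall>\<^sub>F y in nhds x. \<kappa> y = \<kappa> x"
begin

text \<open>\<open>s t \<otimes> inv \<kappa> (h t)\<close> is the label over \<open>V\<close>.
  Eventual constancy plays the part of continuity into a discrete fibre, so \<open>F\<close> carries
  no topology.\<close>

definition is_lift :: "'b::topological_space set \<Rightarrow> ('b \<Rightarrow> 'a) \<Rightarrow> ('b \<Rightarrow> 'f) \<Rightarrow> bool" where
  "is_lift K h s \<longleftrightarrow> (\<forall>t\<in>K. s t \<in> carrier F \<and>
     (h t \<in> U \<longrightarrow> (\<forall>\<^sub>F t' in at t within K. s t' = s t)) \<and>
     (h t \<in> V \<longrightarrow> (\<forall>\<^sub>F t' in at t within K. s t' \<otimes> inv \<kappa> (h t') = s t \<otimes> inv \<kappa> (h t))))"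

lemma is_lift_closed: "is_lift K h s \<Longrightarrow> t \<in> K \<Longrightarrow> s t \<in> carrier F"
  by (simp add: is_lift_def)

lemma inv_cancel_left: "k \<in> carrier F \<Longrightarrow> z \<in> carrier F \<Longrightarrow> inv k \<otimes> (k \<otimes> z) = z"
  by (simp add: m_assoc[symmetric])

text \<open>Transition functions multiply labels on the right, so they cancel in
  \<open>s t \<otimes> inv (s' t)\<close>, which is therefore locally constant on the connected set
  \<open>K\<close>.\<close>

lemma is_lift_unique:
  assumes s: "is_lift K h s" and s': "is_lift K h s'" and "connected K" "h ` K \<subseteq> U \<union> V"
    and "a \<in> K" "b \<in> K"
  shows "s a \<otimes> inv (s' a) = s b \<otimes> inv (s' b)"
proof (rule connected_local_const[of K a b "\<lambda>t. s t \<otimes> inv (s' t)"])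
  show "\<forall>t\<in>K. \<forall>\<^sub>F t' in at t within K. s t \<otimes> inv (s' t) = s t' \<otimes> inv (s' t')"
  proof
    fix t assume t: "t \<in> K"
    have K: "\<forall>\<^sub>F t' in at t within K. t' \<in> K"
      by (simp add: eventually_at_filter)
    show "\<forall>\<^sub>F t' in at t within K. s t \<otimes> inv (s' t) = s t' \<otimes> inv (s' t')"
    proof (cases "h t \<in> U")
      case True
      with t s s' have "\<forall>\<^sub>F t' in at t within K. s t' = s t" "\<forall>\<^sub>F t' in at t within K. s' t' = s' t"
        by (auto simp: is_lift_def)
      then show ?thesis
        by eventually_elim simp
    next
      case False
      with t assms(4) have "h t \<in> V"
        by auto
      with t s s' have
        "\<forall>\<^sub>F t' in at t within K. s t' \<otimes> inv \<kappa> (h t') = s t \<otimes> inv \<kappa> (h t)"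
        "\<forall>\<^sub>F t' in at t within K. s' t' \<otimes> inv \<kappa> (h t') = s' t \<otimes> inv \<kappa> (h t)"
        by (auto simp: is_lift_def)
      then show ?thesis
        using K
      proof eventually_elim
        case (elim t')
        have *: "(x \<otimes> inv k) \<otimes> inv (y \<otimes> inv k) = x \<otimes> inv y"
          if "x \<in> carrier F" "y \<in> carrier F" "k \<in> carrier F" for x y k
          using that by (simp add: inv_mult_group m_assoc inv_cancel_left)
        show ?case
          using *[of "s t" "s' t" "\<kappa> (h t)"] *[of "s t'" "s' t'" "\<kappa> (h t')"] elim t s s'
          by (simp add: is_lift_closed)
      qed
    qed
  qed
qed (use assms in auto)

text \<open>Two lifts differ by a constant left factor, which cancels in this quotient: the
  transport from \<open>a\<close> to \<open>b\<close> depends on \<open>h\<close> alone.\<close>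

lemma is_lift_ratio:
  assumes s: "is_lift K h s" and s': "is_lift K h s'" and "connected K" "h ` K \<subseteq> U \<union> V"
    and "a \<in> K" "b \<in> K"
  shows "inv (s a) \<otimes> s b = inv (s' a) \<otimes> s' b"
proof -
  have c: "s a \<in> carrier F" "s b \<in> carrier F" "s' a \<in> carrier F" "s' b \<in> carrier F"
    using assms by (auto simp: is_lift_closed)
  have "s b = (s b \<otimes> inv (s' b)) \<otimes> s' b"
    using c by (simp add: m_assoc)
  also have "\<dots> = (s a \<otimes> inv (s' a)) \<otimes> s' b"
    using is_lift_unique[OF assms] by simp
  also have "\<dots> = s a \<otimes> (inv (s' a) \<otimes> s' b)"
    using c by (simp add: m_assoc)
  finally have "inv (s a) \<otimes> s b = inv (s a) \<otimes> (s a \<otimes> (inv (s' a) \<otimes> s' b))"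
    by simp
  then show ?thesis
    using c by (simp add: inv_cancel_left)
qed

lemma is_lift_compose:
  assumes s: "is_lift K h s" and \<phi>: "continuous_on K' \<phi>" "\<phi> ` K' \<subseteq> K"
  shows "is_lift K' (\<lambda>t. h (\<phi> t)) (\<lambda>t. s (\<phi> t))"
  unfolding is_lift_def
proof (intro ballI conjI impI)
  fix t assume t: "t \<in> K'"
  then have \<phi>t: "\<phi> t \<in> K"
    using \<phi> by auto
  then show "s (\<phi> t) \<in> carrier F"
    using s by (simp add: is_lift_closed)
  show "\<forall>\<^sub>F t' in at t within K'. s (\<phi> t') = s (\<phi> t)" if "h (\<phi> t) \<in> U"
    by (rule eventually_at_within_compose[OF _ _ \<phi> t]) (use s \<phi>t that in \<open>auto simp: is_lift_def\<close>)
  show "\<forall>\<^sub>F t' in at t within K'. s (\<phi> t') \<otimes> inv \<kappa> (h (\<phi> t')) = s (\<phi> t) \<otimes> inv \<kappa> (h (\<phi> t))"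
    if "h (\<phi> t) \<in> V"
    by (rule eventually_at_within_compose[OF _ _ \<phi> t]) (use s \<phi>t that in \<open>auto simp: is_lift_def\<close>)
qed

lemma is_lift_cong:
  assumes s: "is_lift K h s" and h: "\<And>t. t \<in> K \<Longrightarrow> h t = h' t"
  shows "is_lift K h' s"
  unfolding is_lift_def
proof (intro ballI conjI impI)
  fix t assume t: "t \<in> K"
  have K: "\<forall>\<^sub>F t' in at t within K. t' \<in> K"
    by (simp add: eventually_at_filter)
  show "s t \<in> carrier F"
    using s t by (simp add: is_lift_closed)
  show "\<forall>\<^sub>F t' in at t within K. s t' = s t" if "h' t \<in> U"
    using s t that h by (simp add: is_lift_def)
  show "\<forall>\<^sub>F t' in at t within K. s t' \<otimes> inv \<kappa> (h' t') = s t \<otimes> inv \<kappa> (h' t)" if "h' t \<in> V"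
  proof -
    have "\<forall>\<^sub>F t' in at t within K. s t' \<otimes> inv \<kappa> (h t') = s t \<otimes> inv \<kappa> (h t)"
      using s t that h by (simp add: is_lift_def)
    with K show ?thesis
      by eventually_elim (use t h in simp)
  qed
qed

lemma is_lift_const: "is_lift K (\<lambda>_. x) (\<lambda>_. \<one>)"
  by (simp add: is_lift_def)

lemma \<kappa>_along:
  assumes "continuous_on K h" "t \<in> K" "h t \<in> U \<inter> V"
  shows "\<forall>\<^sub>F t' in at t within K. \<kappa> (h t') = \<kappa> (h t)"
proof -
  have "filterlim h (nhds (h t)) (at t within K)"
    using assms by (simp add: continuous_on_def)
  with \<kappa>_locally[OF assms(3)] show ?thesis
    by (rule eventually_compose_filterlim)
qed

lemma is_lift_in_U:
  assumes "continuous_on K h" "h ` K \<subseteq> U"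
  shows "is_lift K h (\<lambda>_. \<one>)"
  unfolding is_lift_def
proof (intro ballI conjI impI)
  fix t assume t: "t \<in> K" "h t \<in> V"
  then have "\<forall>\<^sub>F t' in at t within K. \<kappa> (h t') = \<kappa> (h t)"
    using assms by (intro \<kappa>_along) auto
  then show "\<forall>\<^sub>F t' in at t within K. \<one> \<otimes> inv \<kappa> (h t') = \<one> \<otimes> inv \<kappa> (h t)"
    by eventually_elim simp
qed simp_all

lemma is_lift_in_V:
  assumes "continuous_on K h" "h ` K \<subseteq> V"
  shows "is_lift K h (\<lambda>t. \<kappa> (h t))"
  unfolding is_lift_def
proof (intro ballI conjI impI)
  fix t assume t: "t \<in> K" "h t \<in> U"
  then show "\<forall>\<^sub>F t' in at t within K. \<kappa> (h t') = \<kappa> (h t)"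
    using assms by (intro \<kappa>_along) auto
qed simp_all

lemma is_lift_translate:
  assumes "is_lift K h s" "g \<in> carrier F"
  shows "is_lift K h (\<lambda>t. g \<otimes> s t)"
  unfolding is_lift_def
proof (intro ballI conjI impI)
  fix t assume t: "t \<in> K"
  have K: "\<forall>\<^sub>F t' in at t within K. t' \<in> K"
    by (simp add: eventually_at_filter)
  show "g \<otimes> s t \<in> carrier F"
    using assms t by (simp add: is_lift_closed)
  show "\<forall>\<^sub>F t' in at t within K. g \<otimes> s t' = g \<otimes> s t" if "h t \<in> U"
  proof -
    have "\<forall>\<^sub>F t' in at t within K. s t' = s t"
      using assms t that by (simp add: is_lift_def)
    then show ?thesis
      by eventually_elim simp
  qed
  show "\<forall>\<^sub>F t' in at t within K. g \<otimes> s t' \<otimes> inv \<kappa> (h t') = g \<otimes> s t \<otimes> inv \<kappa> (h t)" if "h t \<in> V"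
  proof -
    have "\<forall>\<^sub>F t' in at t within K. s t' \<otimes> inv \<kappa> (h t') = s t \<otimes> inv \<kappa> (h t)"
      using assms t that by (simp add: is_lift_def)
    with K show ?thesis
      by eventually_elim (use assms t in \<open>simp add: m_assoc is_lift_closed\<close>)
  qed
qed

lemma is_lift_Un:
  assumes "closed A" "closed B" and "is_lift A h s" "is_lift B h s"
  shows "is_lift (A \<union> B) h s"
proof -
  have split: "eventually P (at t within A \<union> B)"
    if "t \<in> A \<Longrightarrow> eventually P (at t within A)" "t \<in> B \<Longrightarrow> eventually P (at t within B)" for P and t :: 'b
  proof -
    \<comment> \<open>A point off a closed set is no limit point of it, so the condition on that
      half is vacuous.\<close>
    have "at t within C = bot" if "closed C" "t \<notin> C" for C
      using that by (metis closed_limpt trivial_limit_within)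
    then show ?thesis
      using that assms(1,2) by (cases "t \<in> A"; cases "t \<in> B") (simp_all add: at_within_union eventually_sup)
  qed
  show ?thesis
    using assms(3,4) unfolding is_lift_def by (intro ballI conjI impI split) auto
qed

text \<open>A left translation makes \<open>s'\<close> agree with \<open>s\<close> at one point
  \<open>c\<close> of the overlap, and uniqueness on the connected overlap then makes them agree
  throughout it.\<close>

lemma is_lift_glue:
  assumes A: "closed A" "is_lift A h s" and B: "closed B" "is_lift B h s'"
    and "connected (A \<inter> B)" "A \<inter> B \<noteq> {}" "h ` (A \<inter> B) \<subseteq> U \<union> V"
  shows "\<exists>s. is_lift (A \<union> B) h s"
proof -
  obtain c where c: "c \<in> A \<inter> B"
    using assms by blast
  define s'' where "s'' t = (s c \<otimes> inv (s' c)) \<otimes> s' t" for t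
  have cc: "s c \<in> carrier F" "s' c \<in> carrier F"
    using A B c by (auto simp: is_lift_closed)
  then have s'': "is_lift B h s''"
    unfolding s''_def using B by (intro is_lift_translate) auto
  have restrict: "is_lift C h s" if "is_lift D h s" "C \<subseteq> D" for C D s
    using is_lift_compose[OF that(1), of C "\<lambda>x. x"] that(2) by simp
  have eq: "s'' t = s t" if "t \<in> A \<inter> B" for t
  proof -
    have tc: "s t \<in> carrier F" "s' t \<in> carrier F"
      using A B that by (auto simp: is_lift_closed)
    have "s c \<otimes> inv (s' c) = s t \<otimes> inv (s' t)"
      by (rule is_lift_unique[of "A \<inter> B" h]) (use restrict A B assms c that in auto)
    then show ?thesis
      using tc cc by (simp add: s''_def m_assoc)
  qed
  define r where "r t = (if t \<in> A then s t else s'' t)" for t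
  have cong: "is_lift K h r" if "is_lift K h s" "\<And>t. t \<in> K \<Longrightarrow> r t = s t" for K s
    unfolding is_lift_def
  proof (intro ballI conjI impI)
    fix t assume t: "t \<in> K"
    have K: "\<forall>\<^sub>F t' in at t within K. t' \<in> K"
      by (simp add: eventually_at_filter)
    show "r t \<in> carrier F"
      using that t by (simp add: is_lift_closed)
    show "\<forall>\<^sub>F t' in at t within K. r t' = r t" if "h t \<in> U"
    proof -
      have "\<forall>\<^sub>F t' in at t within K. s t' = s t"
        using \<open>is_lift K h s\<close> t that by (simp add: is_lift_def)
      with K show ?thesis
        by eventually_elim (use t \<open>\<And>t. t \<in> K \<Longrightarrow> r t = s t\<close> in simp)
    qed
    show "\<forall>\<^sub>F t' in at t within K. r t' \<otimes> inv \<kappa> (h t') = r t \<otimes> inv \<kappa> (h t)" if "h t \<in> V"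
    proof -
      have "\<forall>\<^sub>F t' in at t within K. s t' \<otimes> inv \<kappa> (h t') = s t \<otimes> inv \<kappa> (h t)"
        using \<open>is_lift K h s\<close> t that by (simp add: is_lift_def)
      with K show ?thesis
        by eventually_elim (use t \<open>\<And>t. t \<in> K \<Longrightarrow> r t = s t\<close> in simp)
    qed
  qed
  have "is_lift A h r" "is_lift B h r"
    using cong[OF A(2)] cong[OF s''] eq by (auto simp: r_def)
  then show ?thesis
    using is_lift_Un[OF A(1) B(1), of h r] by blast
qed

text \<open>Small rectangles are mapped into \<open>U\<close> or into \<open>V\<close>, where
  explicit lifts exist, and lifts on adjacent rectangles glue along the common edge. Bisection,
  first in the second coordinate and then in the first, does the work of a Lebesgue number.\<close>

lemma is_lift_square:
  fixes h :: "real \<times> real \<Rightarrow> 'a"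
  assumes h: "continuous_on ({0..1} \<times> {0..1}) h" "h ` ({0..1} \<times> {0..1}) \<subseteq> U \<union> V"
  shows "\<exists>s. is_lift ({0..1} \<times> {0..1}) h s"
proof -
  \<comment> \<open>The bounds are premises because \<open>Bolzano\<close> also asks about intervals
    that stick out of the unit interval; there \<open>R\<close> holds vacuously.\<close>
  define R where "R a b c e \<longleftrightarrow> (0 \<le> a \<and> a \<le> b \<and> b \<le> 1 \<and> 0 \<le> c \<and> c \<le> e \<and> e \<le> 1 \<longrightarrow>
    (\<exists>s. is_lift ({a..b} \<times> {c..e}) h s))" for a b c e :: real
  have small: "\<exists>d>0. \<forall>a b c e. a \<le> x \<and> x \<le> b \<and> b - a < d \<and> c \<le> y \<and> y \<le> e \<and> e - c < d \<longrightarrow> R a b c e"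
    if xy: "x \<in> {0..1}" "y \<in> {0..1}" for x y
  proof -
    have "(x, y) \<in> {0..1} \<times> {0..1}"
      using xy by simp
    with h(2) have "h (x, y) \<in> U \<union> V"
      by (meson imageI subsetD)
    then obtain W where W: "W = U \<or> W = V" "h (x, y) \<in> W"
      by blast
    then have "open W"
      using U V by auto
    have "(h \<longlongrightarrow> h (x, y)) (at (x, y) within {0..1} \<times> {0..1})"
      using h xy by (simp add: continuous_on_def)
    then have "\<forall>\<^sub>F p in at (x, y) within {0..1} \<times> {0..1}. h p \<in> W"
      using W(2) \<open>open W\<close> by (blast dest: topological_tendstoD)
    then obtain d where d: "d > 0"
      "\<And>p. p \<in> {0..1} \<times> {0..1} \<Longrightarrow> p \<noteq> (x, y) \<Longrightarrow> dist p (x, y) < d \<Longrightarrow> h p \<in> W"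
      unfolding eventually_at by blast
    show ?thesis
    proof (intro exI[of _ "d / 2"] conjI allI impI)
      fix a b c e
      assume *: "a \<le> x \<and> x \<le> b \<and> b - a < d / 2 \<and> c \<le> y \<and> y \<le> e \<and> e - c < d / 2"
      show "R a b c e"
        unfolding R_def
      proof
        assume **: "0 \<le> a \<and> a \<le> b \<and> b \<le> 1 \<and> 0 \<le> c \<and> c \<le> e \<and> e \<le> 1"
        have "h (p, q) \<in> W" if pq: "p \<in> {a..b}" "q \<in> {c..e}" for p q
        proof (cases "(p, q) = (x, y)")
          case False
          have "dist (p, q) (x, y) \<le> \<bar>p - x\<bar> + \<bar>q - y\<bar>"
            unfolding dist_Pair_Pair dist_real_def by (rule order_trans[OF sqrt_sum_squares_le_sum_abs]) simp
          also have "\<dots> < d"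
            using pq * by (auto simp: abs_if)
          finally show ?thesis
            using pq * ** False by (intro d) auto
        qed (use W in simp)
        then have "h ` ({a..b} \<times> {c..e}) \<subseteq> W"
          by blast
        moreover have "continuous_on ({a..b} \<times> {c..e}) h"
          using ** by (intro continuous_on_subset[OF h(1)]) auto
        ultimately show "\<exists>s. is_lift ({a..b} \<times> {c..e}) h s"
          using W(1) is_lift_in_U is_lift_in_V by blast
      qed
    qed (use d in simp)
  qed
  have glue: "\<exists>s. is_lift (A \<union> B) h s"
    if "is_lift A h s" "is_lift B h s'" "closed A" "closed B" "A \<inter> B = {a..b} \<times> {c..e}"
      "0 \<le> a" "a \<le> b" "b \<le> 1" "0 \<le> c" "c \<le> e" "e \<le> 1" for A B s s' a b c e
  proof (rule is_lift_glue)
    show "connected (A \<inter> B)" "A \<inter> B \<noteq> {}"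
      using that by (simp_all add: connected_Times)
    have "{a..b} \<times> {c..e} \<subseteq> {0..1} \<times> {0..1}"
      using that by (intro Sigma_mono) auto
    then show "h ` (A \<inter> B) \<subseteq> U \<union> V"
      unfolding that(5) using h(2) by blast
  qed (use that in auto)
  have glue2: "R a b c e" if R: "R a b c m" "R a b m e" and m: "c \<le> m" "m \<le> e" for a b c m e
    unfolding R_def
  proof
    assume *: "0 \<le> a \<and> a \<le> b \<and> b \<le> 1 \<and> 0 \<le> c \<and> c \<le> e \<and> e \<le> 1"
    then obtain s s' where s: "is_lift ({a..b} \<times> {c..m}) h s" "is_lift ({a..b} \<times> {m..e}) h s'"
      using R m unfolding R_def by (meson order_trans)
    have "{a..b} \<times> {c..m} \<union> {a..b} \<times> {m..e} = {a..b} \<times> {c..e}"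
      "{a..b} \<times> {c..m} \<inter> {a..b} \<times> {m..e} = {a..b} \<times> {m..m}"
      using m by auto
    then show "\<exists>s. is_lift ({a..b} \<times> {c..e}) h s"
      using glue[OF s, of a b m m] * m by (simp add: closed_Times)
  qed
  have glue1: "R a b c e" if R: "R a m c e" "R m b c e" and m: "a \<le> m" "m \<le> b" for a b c m e
    unfolding R_def
  proof
    assume *: "0 \<le> a \<and> a \<le> b \<and> b \<le> 1 \<and> 0 \<le> c \<and> c \<le> e \<and> e \<le> 1"
    then obtain s s' where s: "is_lift ({a..m} \<times> {c..e}) h s" "is_lift ({m..b} \<times> {c..e}) h s'"
      using R m unfolding R_def by (meson order_trans)
    have "{a..m} \<times> {c..e} \<union> {m..b} \<times> {c..e} = {a..b} \<times> {c..e}"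
      "{a..m} \<times> {c..e} \<inter> {m..b} \<times> {c..e} = {m..m} \<times> {c..e}"
      using m by auto
    then show "\<exists>s. is_lift ({a..b} \<times> {c..e}) h s"
      using glue[OF s, of m m c e] * m by (simp add: closed_Times)
  qed
  have strip: "\<exists>d>0. \<forall>a b. a \<le> x \<and> x \<le> b \<and> b - a < d \<longrightarrow> R a b 0 1" if x: "x \<in> {0..1}" for x
  proof -
    \<comment> \<open>The width of the strip is quantified inside \<open>Q\<close>, so each gluing
      may pass to the smaller of two widths.\<close>
    define Q where "Q c e \<longleftrightarrow> (\<exists>d>0. \<forall>a b. a \<le> x \<and> x \<le> b \<and> b - a < d \<longrightarrow> R a b c e)" for c e
    have "0 \<le> (1::real)"
      by simp
    then have "Q 0 1"
    proof (induction rule: Bolzano)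
      case (trans c m e)
      obtain d where d: "d > 0" "\<And>a b. a \<le> x \<and> x \<le> b \<and> b - a < d \<Longrightarrow> R a b c m"
        using trans(1) unfolding Q_def by blast
      obtain d' where d': "d' > 0" "\<And>a b. a \<le> x \<and> x \<le> b \<and> b - a < d' \<Longrightarrow> R a b m e"
        using trans(2) unfolding Q_def by blast
      have "R a b c e" if "a \<le> x \<and> x \<le> b \<and> b - a < min d d'" for a b
        by (rule glue2[OF d(2) d'(2) trans(3,4)]) (use that in auto)
      moreover have "min d d' > 0"
        using d d' by simp
      ultimately show ?case
        unfolding Q_def by blast
    next
      case (local y)
      then obtain d where d: "d > 0"
        "\<And>a b c e. a \<le> x \<and> x \<le> b \<and> b - a < d \<and> c \<le> y \<and> y \<le> e \<and> e - c < d \<Longrightarrow> R a b c e"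
        using small[of x y] x by auto
      then show ?case
        unfolding Q_def by blast
    qed
    then show ?thesis
      by (simp add: Q_def)
  qed
  have "0 \<le> (1::real)"
    by simp
  then have "R 0 1 0 1"
  proof (induction rule: Bolzano[where P = "\<lambda>a b. R a b 0 1"])
    case (trans a m b)
    then show ?case
      using glue1 by blast
  next
    case (local x)
    then show ?case
      using strip[of x] by simp
  qed
  then show ?thesis
    by (simp add: R_def)
qed

section \<open>Monodromy of paths and its homotopy invariance\<close>

definition label :: "(real \<Rightarrow> 'a) \<Rightarrow> 'f" where
  "label f = (SOME g. \<exists>s. is_lift {0..1} f s \<and> g = inv (s 0) \<otimes> s 1)"

lemma label_eq:
  assumes s: "is_lift {0..1} f s" and "path_image f \<subseteq> U \<union> V"
  shows "label f = inv (s 0) \<otimes> s 1"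
  unfolding label_def
proof (rule some_equality)
  fix g assume "\<exists>s. is_lift {0..1} f s \<and> g = inv (s 0) \<otimes> s 1"
  then obtain s' where s': "is_lift {0..1} f s'" "g = inv (s' 0) \<otimes> s' 1"
    by blast
  moreover have "f ` {0..1} \<subseteq> U \<union> V"
    using assms(2) by (simp add: path_image_def)
  ultimately show "g = inv (s 0) \<otimes> s 1"
    using is_lift_ratio[OF s'(1) s, of 0 1] by simp
qed (use s in blast)

lemma is_lift_path:
  assumes "path f" "path_image f \<subseteq> U \<union> V"
  obtains s where "is_lift {0..1} f s"
proof -
  \<comment> \<open>The path becomes a square that is constant in the first coordinate, and the lift
    is restricted to one side of it.\<close>
  have "continuous_on ({0..1} \<times> {0..1}) (\<lambda>p::real \<times> real. f (snd p))"
    by (rule continuous_on_compose2[of "{0..1}" f])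
       (use assms(1) in \<open>auto simp: path_def intro!: continuous_intros\<close>)
  moreover have "(\<lambda>p::real \<times> real. f (snd p)) ` ({0..1} \<times> {0..1}) \<subseteq> U \<union> V"
    using assms(2) by (auto simp: path_image_def)
  ultimately obtain s where "is_lift ({0..1} \<times> {0..1}) (\<lambda>p::real \<times> real. f (snd p)) s"
    using is_lift_square by blast
  then have "is_lift {0..1} (\<lambda>t. f (snd (0::real, t))) (\<lambda>t. s (0, t))"
    by (rule is_lift_compose) (auto intro!: continuous_intros)
  then show ?thesis
    using that by simp
qed

lemma label_closed:
  assumes "path f" "path_image f \<subseteq> U \<union> V"
  shows "label f \<in> carrier F"
proof -
  obtain s where "is_lift {0..1} f s"
    using assms by (rule is_lift_path)
  then show ?thesis
    using assms by (simp add: label_eq is_lift_closed)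
qed

text \<open>One lift of the joined path restricts to lifts of both halves, and the label at the
  middle telescopes. The order \<open>inv (s 0) \<otimes> s 1\<close> is what makes
  \<open>label\<close> multiplicative and not order-reversing.\<close>

lemma label_join:
  assumes "path f" "path_image f \<subseteq> U \<union> V" "path g" "path_image g \<subseteq> U \<union> V" "pathfinish f = pathstart g"
  shows "label (f +++ g) = label f \<otimes> label g"
proof -
  have "path (f +++ g)" "path_image (f +++ g) \<subseteq> U \<union> V"
    using assms by (simp_all add: subset_path_image_join)
  then obtain s where s: "is_lift {0..1} (f +++ g) s"
    by (rule is_lift_path)
  have "is_lift {0..1} (\<lambda>t. (f +++ g) (t / 2)) (\<lambda>t. s (t / 2))"
    using s by (rule is_lift_compose) (auto intro!: continuous_intros)
  then have "is_lift {0..1} f (\<lambda>t. s (t / 2))"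
    by (rule is_lift_cong) (simp add: joinpaths_def)
  then have "label f = inv (s (0 / 2)) \<otimes> s (1 / 2)"
    using assms(2) by (rule label_eq)
  then have f: "label f = inv (s 0) \<otimes> s (1 / 2)"
    by simp
  have "is_lift {0..1} (\<lambda>t. (f +++ g) ((t + 1) / 2)) (\<lambda>t. s ((t + 1) / 2))"
    using s by (rule is_lift_compose) (auto intro!: continuous_intros)
  then have "is_lift {0..1} g (\<lambda>t. s ((t + 1) / 2))"
    by (rule is_lift_cong) (use assms(5) in \<open>auto simp: joinpaths_def pathstart_def pathfinish_def add_divide_distrib\<close>)
  then have "label g = inv (s ((0 + 1) / 2)) \<otimes> s ((1 + 1) / 2)"
    using assms(4) by (rule label_eq)
  then have g: "label g = inv (s (1 / 2)) \<otimes> s 1"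
    by simp
  have c: "s 0 \<in> carrier F" "s (1 / 2) \<in> carrier F" "s 1 \<in> carrier F"
    using s by (auto intro: is_lift_closed)
  have "s (1 / 2) \<otimes> (inv (s (1 / 2)) \<otimes> s 1) = s 1"
    using c by (simp add: m_assoc[symmetric])
  then show ?thesis
    using assms c by (simp add: f g label_eq[OF s] subset_path_image_join m_assoc)
qed

text \<open>A lift of the whole homotopy is constant along the two sides on which the homotopy rests
  at an endpoint, so the lifts of \<open>f\<close> and \<open>g\<close> that it contains have the
  same end labels.\<close>

lemma label_homotopic:
  assumes "homotopic_paths (U \<union> V) f g"
  shows "label f = label g"
proof -
  obtain h where h: "continuous_on ({0..1} \<times> {0..1}) h" "h ` ({0..1} \<times> {0..1}) \<subseteq> U \<union> V"
    and f: "\<And>t. t \<in> {0..1} \<Longrightarrow> h (0, t) = f t" and g: "\<And>t. t \<in> {0..1} \<Longrightarrow> h (1, t) = g t"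
    and ends: "\<And>t. t \<in> {0..1::real} \<Longrightarrow> h (t, 0) = f 0" "\<And>t. t \<in> {0..1::real} \<Longrightarrow> h (t, 1) = f 1"
    using assms unfolding homotopic_paths
    by (auto simp: pathstart_def pathfinish_def image_subset_iff_funcset)
  obtain s where s: "is_lift ({0..1} \<times> {0..1}) h s"
    using is_lift_square[OF h] by blast
  have imgs: "path_image f \<subseteq> U \<union> V" "path_image g \<subseteq> U \<union> V"
    using homotopic_paths_imp_subset[OF assms] by auto
  have "is_lift {0..1} (\<lambda>t. h (0, t)) (\<lambda>t. s (0, t))" "is_lift {0..1} (\<lambda>t. h (1, t)) (\<lambda>t. s (1, t))"
    by (rule is_lift_compose[OF s]; auto intro!: continuous_intros)+
  then have "is_lift {0..1} f (\<lambda>t. s (0, t))" "is_lift {0..1} g (\<lambda>t. s (1, t))"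
    using f g by (auto elim: is_lift_cong)
  then have fg: "label f = inv (s (0, 0)) \<otimes> s (0, 1)" "label g = inv (s (1, 0)) \<otimes> s (1, 1)"
    using label_eq imgs by auto
  have side: "s (0, y) = s (1, y)" if y: "y = 0 \<or> y = 1" for y
  proof -
    have c: "s (0, y) \<in> carrier F" "s (1, y) \<in> carrier F"
      using s y by (auto intro: is_lift_closed)
    have "is_lift {0..1} (\<lambda>t. h (t, y)) (\<lambda>t. s (t, y))"
      by (rule is_lift_compose[OF s]) (use y in \<open>auto intro!: continuous_intros\<close>)
    then have "is_lift {0..1} (\<lambda>_. f y) (\<lambda>t. s (t, y))"
      by (rule is_lift_cong) (use y ends in auto)
    moreover have "f y \<in> path_image f"
      using y by (auto simp: path_image_def)
    then have "f y \<in> U \<union> V"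
      using imgs by blast
    ultimately have "s (0, y) \<otimes> inv \<one> = s (1, y) \<otimes> inv \<one>"
      by (intro is_lift_unique[OF _ is_lift_const]) auto
    then show ?thesis
      using c by simp
  qed
  show ?thesis
    using side by (simp add: fg)
qed

lemma label_in_U:
  assumes "path f" "path_image f \<subseteq> U"
  shows "label f = \<one>"
  using label_eq[OF is_lift_in_U[of "{0..1}" f]] assms by (auto simp: path_def path_image_def)

text \<open>A path in \<open>V\<close> can keep its label over \<open>V\<close> constant; expressed
  over \<open>U\<close>, this lift is \<open>\<kappa> \<circ> f\<close>.\<close>

lemma label_in_V:
  assumes "path f" "path_image f \<subseteq> V"
  shows "label f = inv \<kappa> (pathstart f) \<otimes> \<kappa> (pathfinish f)"
  using label_eq[OF is_lift_in_V[of "{0..1}" f]] assms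
  by (auto simp: path_def path_image_def pathstart_def pathfinish_def)

end


section \<open>A van Kampen theorem\<close>

lemma simply_connected_homotopic_paths:
  fixes S :: "'a::real_normed_vector set"
  assumes "simply_connected S" "path f" "path_image f \<subseteq> S" "path g" "path_image g \<subseteq> S"
    "pathstart g = pathstart f" "pathfinish g = pathfinish f"
  shows "homotopic_paths S f g"
  using assms by (simp add: simply_connected_eq_homotopic_paths)

text \<open>The generator of a component runs from \<open>p\<close> through \<open>V\<close> into
  that component and back through \<open>U\<close>. Monodromy in the covering glued by
  \<open>\<kappa>\<close> reads off a word for each loop, and evaluating this word in the
  fundamental group recovers the loop.\<close>

theorem fundamental_group_Un_simply_connected:
  fixes U V :: "'a::real_normed_vector set"
  assumes U: "open U" "simply_connected U" and V: "open V" "simply_connected V" and p: "p \<in> U \<inter> V"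
  shows "fundamental_group (U \<union> V) p
    \<cong> free_group (components (U \<inter> V) - {connected_component_set (U \<inter> V) p})"
proof -
  define S where "S = U \<union> V"
  define C where "C x = connected_component_set (U \<inter> V) x" for x
  define X where "X = components (U \<inter> V) - {C p}"
  \<comment> \<open>The component of \<open>p\<close> gets the neutral label, which normalises
    labels at the base point. The value \<open>[]\<close> on \<open>V - U\<close> matches
    \<open>e_outside\<close> below.\<close>
  define \<kappa> where "\<kappa> x = (if x \<in> U \<inter> V \<and> C x \<noteq> C p then [(C x, True)] else [])" for x
  have C_self: "x \<in> C x" if "x \<in> U \<inter> V" for x
    using that by (simp add: C_def connected_component_refl)
  have C_sub: "C x \<subseteq> U \<inter> V" for x
    unfolding C_def by (rule connected_component_subset)
  have C_eq: "C y = C x" if "y \<in> C x" for x y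
    using that unfolding C_def by (metis connected_component_eq mem_Collect_eq)
  have C_open: "open (C x)" for x
    unfolding C_def using U V by (intro open_connected_component open_Int)
  interpret F: sheet_labels "free_group X" U V \<kappa>
  proof (intro sheet_labels.intro group_free_group sheet_labels_axioms.intro U V)
    show "\<kappa> x \<in> carrier (free_group X)" for x
      by (auto simp: \<kappa>_def carrier_free_group X_def C_def intro: componentsI)
    show "\<forall>\<^sub>F y in nhds x. \<kappa> y = \<kappa> x" if x: "x \<in> U \<inter> V" for x
    proof -
      have "\<forall>\<^sub>F y in nhds x. y \<in> C x"
        using C_open C_self[OF x] by (rule eventually_nhds_in_open)
      then show ?thesis
      proof eventually_elim
        case (elim y)
        then show ?case
          using x C_eq[OF elim] C_sub[of x] by (auto simp: \<kappa>_def)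
      qed
    qed
  qed
  have pS: "p \<in> S"
    using p by (simp add: S_def)
  interpret \<pi>: group "fundamental_group S p"
    using pS by (rule group_fundamental_group)
  let ?G = "fundamental_group S p"
  have path_choice: "\<exists>c. \<forall>x\<in>W. path (c x) \<and> path_image (c x) \<subseteq> W \<and> pathstart (c x) = p \<and> pathfinish (c x) = x"
    if "simply_connected W" "p \<in> W" for W
  proof (rule bchoice, rule ballI)
    fix x assume "x \<in> W"
    then show "\<exists>g. path g \<and> path_image g \<subseteq> W \<and> pathstart g = p \<and> pathfinish g = x"
      using simply_connected_imp_path_connected[OF that(1)] that(2) unfolding path_connected_def by blast
  qed
  obtain b where b: "\<And>x. x \<in> U \<Longrightarrow> path (b x)" "\<And>x. x \<in> U \<Longrightarrow> path_image (b x) \<subseteq> U"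
      "\<And>x. x \<in> U \<Longrightarrow> pathstart (b x) = p" "\<And>x. x \<in> U \<Longrightarrow> pathfinish (b x) = x"
    using path_choice[OF U(2)] p by blast
  obtain d where d: "\<And>x. x \<in> V \<Longrightarrow> path (d x)" "\<And>x. x \<in> V \<Longrightarrow> path_image (d x) \<subseteq> V"
      "\<And>x. x \<in> V \<Longrightarrow> pathstart (d x) = p" "\<And>x. x \<in> V \<Longrightarrow> pathfinish (d x) = x"
    using path_choice[OF V(2)] p by blast
  \<comment> \<open>Base paths stay in \<open>U\<close> wherever they can, so closing up a path in
    \<open>U\<close> yields a loop in \<open>U\<close>, which is trivial.\<close>
  define c where "c x = (if x \<in> U then b x else d x)" for x
  have c: "path (c x)" "path_image (c x) \<subseteq> S" "pathstart (c x) = p" "pathfinish (c x) = x" if "x \<in> S" for x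
    using that b[of x] d[of x] by (auto simp: c_def S_def)
  have cU: "path (c x)" "path_image (c x) \<subseteq> U" "pathstart (c x) = p" "pathfinish (c x) = x" if "x \<in> U" for x
    using that b[of x] by (auto simp: c_def)
  have ends: "pathstart f \<in> W" "pathfinish f \<in> W" if "path_image f \<subseteq> W" for f :: "real \<Rightarrow> 'a" and W
    using that by auto
  have const: "linepath p p = (\<lambda>_. p)"
    by (rule linepath_refl)
  have one: "\<one>\<^bsub>?G\<^esub> = path_class S (linepath p p)"
    by (simp add: fundamental_group_def const)
  \<comment> \<open>Closing up with base paths turns every path into a loop at \<open>p\<close>, so
    the pieces of a subdivided loop have classes in the same group.\<close>
  define \<tau> where "\<tau> f = path_class S (c (pathstart f) +++ (f +++ reversepath (c (pathfinish f))))" for f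
  have \<tau>_loop: "c (pathstart f) +++ (f +++ reversepath (c (pathfinish f))) \<in> loops_at S p"
    if "path f" "path_image f \<subseteq> S" for f
    using that c ends[OF that(2)] by (simp add: loops_at_def subset_path_image_join)
  have \<tau>_closed: "\<tau> f \<in> carrier ?G" if "path f" "path_image f \<subseteq> S" for f
    using \<tau>_loop[OF that] by (simp add: \<tau>_def carrier_fundamental_group)
  have \<tau>_homotopic: "\<tau> f = \<tau> g" if fg: "homotopic_paths S f g" for f g
  proof -
    have f: "path f" "path_image f \<subseteq> S"
      using homotopic_paths_imp_path[OF fg] homotopic_paths_imp_subset[OF fg] by auto
    then have "homotopic_paths S (c (pathstart f) +++ (f +++ reversepath (c (pathfinish f))))
        (c (pathstart f) +++ (g +++ reversepath (c (pathfinish f))))"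
      using c ends[OF f(2)] by (intro homotopic_paths_conj[OF fg]) simp_all
    then show ?thesis
      using homotopic_paths_imp_pathstart[OF fg] homotopic_paths_imp_pathfinish[OF fg]
      unfolding \<tau>_def by (simp add: path_class_eqI)
  qed
  have \<tau>_join: "\<tau> (f +++ g) = \<tau> f \<otimes>\<^bsub>?G\<^esub> \<tau> g"
    if f: "path f" "path_image f \<subseteq> S" and g: "path g" "path_image g \<subseteq> S" and fg: "pathfinish f = pathstart g"
    for f g
  proof -
    have "homotopic_paths S
        ((c (pathstart f) +++ (f +++ reversepath (c (pathfinish f)))) +++
         (c (pathfinish f) +++ (g +++ reversepath (c (pathfinish g)))))
        (c (pathstart f) +++ ((f +++ g) +++ reversepath (c (pathfinish g))))"
      using f g fg c ends[OF f(2)] ends[OF g(2)] by (intro homotopic_paths_conj_join) simp_all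
    then show ?thesis
      using mult_path_class[OF \<tau>_loop[OF f] \<tau>_loop[OF g]] fg
      unfolding \<tau>_def by (simp add: path_class_eqI)
  qed
  have \<tau>_U: "\<tau> f = \<one>\<^bsub>?G\<^esub>" if f: "path f" "path_image f \<subseteq> U" for f
  proof -
    have "homotopic_paths U (c (pathstart f) +++ (f +++ reversepath (c (pathfinish f)))) (linepath p p)"
      using f cU ends[OF f(2)] p
      by (intro simply_connected_homotopic_paths[OF U(2)]) (simp_all add: subset_path_image_join)
    then have "homotopic_paths S (c (pathstart f) +++ (f +++ reversepath (c (pathfinish f)))) (linepath p p)"
      by (rule homotopic_paths_subset) (simp add: S_def)
    then show ?thesis
      by (simp add: \<tau>_def one path_class_eqI)
  qed
  have d_S: "path (d x)" "path_image (d x) \<subseteq> S" "pathstart (d x) = p" "pathfinish (d x) = x" if "x \<in> V" for x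
    using d[OF that] by (auto simp: S_def)
  \<comment> \<open>For a point of \<open>U \<inter> V\<close> this class goes out through
    \<open>V\<close> and returns through \<open>U\<close>: it compares the two base paths to the
    point.\<close>
  define e where "e x = \<tau> (d x)" for x
  have e_closed: "e x \<in> carrier ?G" if "x \<in> V" for x
    unfolding e_def using d_S[OF that] by (intro \<tau>_closed)
  \<comment> \<open>The counterpart of \<open>label_in_V\<close>: over \<open>V\<close>, the class
    \<open>\<tau> f\<close> is a quotient of values of \<open>e\<close>, just as the label is a
    quotient of values of \<open>\<kappa>\<close>.\<close>
  have e_step: "e (pathstart f) \<otimes>\<^bsub>?G\<^esub> \<tau> f = e (pathfinish f)" if f: "path f" "path_image f \<subseteq> V" for f
  proof -
    have fS: "path_image f \<subseteq> S"
      using f by (auto simp: S_def)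
    have "homotopic_paths V (d (pathstart f) +++ f) (d (pathfinish f))"
      using f d ends[OF f(2)]
      by (intro simply_connected_homotopic_paths[OF V(2)]) (simp_all add: subset_path_image_join)
    then have "homotopic_paths S (d (pathstart f) +++ f) (d (pathfinish f))"
      by (rule homotopic_paths_subset) (simp add: S_def)
    then have "\<tau> (d (pathstart f) +++ f) = e (pathfinish f)"
      unfolding e_def by (rule \<tau>_homotopic)
    moreover have "\<tau> (d (pathstart f) +++ f) = e (pathstart f) \<otimes>\<^bsub>?G\<^esub> \<tau> f"
      unfolding e_def using f fS d_S ends[OF f(2)] by (intro \<tau>_join) simp_all
    ultimately show ?thesis
      by simp
  qed
  have e_outside: "e x = \<one>\<^bsub>?G\<^esub>" if x: "x \<in> V" "x \<notin> U" for x
  proof -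
    note [trans] = homotopic_paths_trans
    have cp: "path (c p)" "path_image (c p) \<subseteq> S" "pathstart (c p) = p" "pathfinish (c p) = p"
      using c[OF pS] by simp_all
    have "homotopic_paths S (c p +++ (d x +++ reversepath (d x))) (c p +++ linepath p p)"
      using cp d_S[OF x(1)] homotopic_paths_rinv[of "d x" S] by (intro homotopic_paths_join) simp_all
    also have "homotopic_paths S \<dots> (c p)"
      using cp by (intro homotopic_paths_rid') simp_all
    also have "homotopic_paths S (c p) (linepath p p)"
      using cU[of p] p
      by (intro homotopic_paths_subset[OF simply_connected_homotopic_paths[OF U(2)]]) (simp_all add: S_def)
    finally show ?thesis
      using x d[OF x(1)] by (simp add: e_def \<tau>_def one c_def path_class_eqI)
  qed
  have e_p: "e p = \<one>\<^bsub>?G\<^esub>"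
  proof -
    have "homotopic_paths S (d p) (linepath p p)"
      using d[of p] p
      by (intro homotopic_paths_subset[OF simply_connected_homotopic_paths[OF V(2)]]) (simp_all add: S_def)
    then have "e p = \<tau> (linepath p p)"
      unfolding e_def by (rule \<tau>_homotopic)
    also have "\<dots> = \<one>\<^bsub>?G\<^esub>"
      using p by (intro \<tau>_U) simp_all
    finally show ?thesis .
  qed
  \<comment> \<open>A path inside the component lies in both sets: as a path in \<open>U\<close> it
    has trivial \<open>\<tau>\<close>, and as a path in \<open>V\<close> it is subject to
    \<open>e_step\<close>.\<close>
  have e_comp: "e x = e y" if x: "x \<in> U \<inter> V" and y: "y \<in> C x" for x y
  proof -
    have "path_connected (C x)"
      using C_open[of x] unfolding C_def by (intro connected_open_path_connected) simp_all
    then obtain r where r: "path r" "path_image r \<subseteq> C x" "pathstart r = x" "pathfinish r = y"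
      using C_self[OF x] y unfolding path_connected_def by blast
    then have "path_image r \<subseteq> U" "path_image r \<subseteq> V"
      using C_sub[of x] by auto
    then have "e x \<otimes>\<^bsub>?G\<^esub> \<one>\<^bsub>?G\<^esub> = e y"
      using e_step[of r] \<tau>_U[of r] r by simp
    then show ?thesis
      using e_closed[of x] x by simp
  qed
  \<comment> \<open>By \<open>e_comp\<close> any point may represent its component. The value off
    \<open>X\<close> makes \<open>\<epsilon>\<close> a total function into the group, as the
    evaluation lemmas require.\<close>
  define \<epsilon> where "\<epsilon> W = (if W \<in> X then e (SOME x. x \<in> W) else \<one>\<^bsub>?G\<^esub>)" for W
  have X_some: "(SOME x. x \<in> W) \<in> W" "(SOME x. x \<in> W) \<in> U \<inter> V" "C (SOME x. x \<in> W) = W" if W: "W \<in> X" for W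
  proof -
    obtain x where x: "x \<in> U \<inter> V" "W = C x"
      using W by (auto simp: X_def C_def components_def)
    then show *: "(SOME x. x \<in> W) \<in> W"
      using C_self by (metis someI)
    then show "(SOME x. x \<in> W) \<in> U \<inter> V" "C (SOME x. x \<in> W) = W"
      using x C_sub C_eq by blast+
  qed
  have \<epsilon>_closed: "\<epsilon> W \<in> carrier ?G" for W
    using X_some(2)[of W] by (auto simp: \<epsilon>_def intro: e_closed)
  let ?ev = "\<pi>.eval_word \<epsilon>"
  note ev_closed = \<pi>.eval_word_closed[where e = \<epsilon>, OF \<epsilon>_closed]
  note ev_Nil = \<pi>.eval_word_Nil[where e = \<epsilon>, OF \<epsilon>_closed]
  interpret ev: group_hom "free_group X" ?G ?ev
    by unfold_locales (auto simp: hom_def ev_closed \<pi>.eval_word_mult[where e = \<epsilon>, OF \<epsilon>_closed])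
  have ev_\<kappa>: "?ev (\<kappa> x) = e x" if x: "x \<in> V" for x
  proof (cases "x \<in> U")
    case True
    then have xUV: "x \<in> U \<inter> V"
      using x by simp
    show ?thesis
    proof (cases "C x = C p")
      case True
      then have "x \<in> C p"
        using C_self[OF xUV] by simp
      then show ?thesis
        using True e_comp[OF p] e_p by (simp add: \<kappa>_def ev_Nil)
    next
      case False
      then have W: "C x \<in> X"
        using xUV by (auto simp: X_def C_def intro: componentsI)
      have "?ev (\<kappa> x) = e (SOME y. y \<in> C x)"
        using False xUV W \<pi>.eval_word_Cons[where e = \<epsilon>, OF \<epsilon>_closed, where k = "(C x, True)" and w = "[]"] \<epsilon>_closed[of "C x"]
        by (simp add: \<kappa>_def ev_Nil \<pi>.eval_letter_def \<epsilon>_def)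
      then show ?thesis
        using e_comp[OF xUV X_some(1)[OF W]] by simp
    qed
  qed (use x e_outside ev_Nil in \<open>simp add: \<kappa>_def\<close>)
  \<comment> \<open>Both sides are multiplicative in the path and agree on pieces inside
    \<open>U\<close> or \<open>V\<close>; bisection extends the equality to all of
    \<open>f\<close>.\<close>
  have ev_label: "?ev (F.label f) = \<tau> f" if f: "path f" "path_image f \<subseteq> S" for f
  proof -
    define P where "P a b \<longleftrightarrow> (0 \<le> a \<and> a \<le> b \<and> b \<le> 1 \<longrightarrow>
      ?ev (F.label (subpath a b f)) = \<tau> (subpath a b f))" for a b
    have sub: "path (subpath a b f)" "path_image (subpath a b f) \<subseteq> S" if "a \<in> {0..1}" "b \<in> {0..1}" for a b
      using that f path_image_subpath_subset[of a b f] by auto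
    have "0 \<le> (1::real)"
      by simp
    then have "P 0 1"
    proof (induction rule: Bolzano)
      case (trans a m b)
      show ?case
        unfolding P_def
      proof
        assume "0 \<le> a \<and> a \<le> b \<and> b \<le> 1"
        with trans have I: "a \<in> {0..1}" "m \<in> {0..1}" "b \<in> {0..1}"
          and IH: "?ev (F.label (subpath a m f)) = \<tau> (subpath a m f)"
            "?ev (F.label (subpath m b f)) = \<tau> (subpath m b f)"
          by (auto simp: P_def)
        let ?j = "subpath a m f +++ subpath m b f"
        have j: "homotopic_paths S ?j (subpath a b f)"
          using f I by (intro homotopic_join_subpaths)
        have "?ev (F.label (subpath a b f)) = ?ev (F.label ?j)"
          using F.label_homotopic j by (simp add: S_def)
        also have "F.label ?j = F.label (subpath a m f) \<otimes>\<^bsub>free_group X\<^esub> F.label (subpath m b f)"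
          using sub I by (intro F.label_join) (simp_all add: S_def)
        also have "?ev \<dots> = \<tau> (subpath a m f) \<otimes>\<^bsub>?G\<^esub> \<tau> (subpath m b f)"
          using sub I IH by (subst ev.hom_mult) (simp_all add: F.label_closed S_def)
        also have "\<dots> = \<tau> ?j"
          using sub I by (intro \<tau>_join[symmetric]) simp_all
        also have "\<dots> = \<tau> (subpath a b f)"
          using j by (rule \<tau>_homotopic)
        finally show "?ev (F.label (subpath a b f)) = \<tau> (subpath a b f)" .
      qed
    next
      case (local x)
      have x: "x \<in> {0..1}"
        using local by simp
      then have "f x \<in> path_image f"
        by (auto simp: path_image_def)
      then have "f x \<in> U \<union> V"
        using f by (auto simp: S_def)
      then obtain W where W: "W = U \<or> W = V" "f x \<in> W"
        by blast
      then have "open W"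
        using U V by auto
      have "(f \<longlongrightarrow> f x) (at x within {0..1})"
        using f x by (simp add: path_def continuous_on_def)
      then have "\<forall>\<^sub>F t in at x within {0..1}. f t \<in> W"
        using W(2) \<open>open W\<close> by (blast dest: topological_tendstoD)
      then obtain \<delta> where \<delta>: "\<delta> > 0" "\<And>t. t \<in> {0..1} \<Longrightarrow> t \<noteq> x \<Longrightarrow> dist t x < \<delta> \<Longrightarrow> f t \<in> W"
        unfolding eventually_at by blast
      show ?case
      proof (intro exI[of _ \<delta>] conjI allI impI)
        fix a b assume ab: "a \<le> x \<and> x \<le> b \<and> b - a < \<delta>"
        show "P a b"
          unfolding P_def
        proof
          assume ab': "0 \<le> a \<and> a \<le> b \<and> b \<le> 1"
          let ?s = "subpath a b f"
          have s: "path ?s"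
            using ab' by (intro sub) auto
          have "path_image ?s = f ` {a..b}"
            using ab' by (simp add: path_image_subpath)
          moreover have "f t \<in> W" if "t \<in> {a..b}" for t
            using that ab ab' W(2) \<delta>(2)[of t] by (cases "t = x") (auto simp: dist_real_def)
          ultimately have sW: "path_image ?s \<subseteq> W"
            by auto
          from W(1) show "?ev (F.label ?s) = \<tau> ?s"
          proof
            assume "W = U"
            then show ?thesis
              using s sW by (simp add: F.label_in_U \<tau>_U ev_Nil)
          next
            assume "W = V"
            with sW have sV: "path_image ?s \<subseteq> V"
              by simp
            then have "e (pathstart ?s) \<otimes>\<^bsub>?G\<^esub> \<tau> ?s = e (pathfinish ?s)"
              using s by (intro e_step)
            moreover have "\<tau> ?s \<in> carrier ?G"
              using s sV by (intro \<tau>_closed) (auto simp: S_def)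
            moreover note ends[OF sV]
            ultimately have "\<tau> ?s = inv\<^bsub>?G\<^esub> e (pathstart ?s) \<otimes>\<^bsub>?G\<^esub> e (pathfinish ?s)"
              using e_closed \<pi>.inv_solve_left by metis
            moreover have "?ev (F.label ?s) = inv\<^bsub>?G\<^esub> e (pathstart ?s) \<otimes>\<^bsub>?G\<^esub> e (pathfinish ?s)"
              using s sV ends[OF sV] ev.hom_mult[of "inv\<^bsub>free_group X\<^esub> \<kappa> (pathstart ?s)" "\<kappa> (pathfinish ?s)"]
                ev.hom_inv[of "\<kappa> (pathstart ?s)"]
              by (simp only: F.label_in_V ev_\<kappa> F.\<kappa>_closed F.inv_closed)
            ultimately show ?thesis
              by simp
          qed
        qed
      qed (use \<delta> in simp)
    qed
    then show ?thesis
      by (simp add: P_def)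
  qed
  define \<Psi> where "\<Psi> A = F.label (SOME f. f \<in> A)" for A
  have \<Psi>: "\<Psi> (path_class S f) = F.label f" if "f \<in> loops_at S p" for f
    using F.label_homotopic[OF path_class_some[OF that, unfolded S_def]] by (simp add: \<Psi>_def S_def)
  have loopD: "path f" "path_image f \<subseteq> U \<union> V" "pathstart f = p" "pathfinish f = p" if "f \<in> loops_at S p" for f
    using that by (simp_all add: loops_at_def S_def)
  have "\<Psi> \<in> iso ?G (free_group X)"
  proof (rule \<pi>.iso_free_groupI[where e = \<epsilon>, OF \<epsilon>_closed])
    show "\<Psi> \<in> hom ?G (free_group X)"
    proof (rule homI)
      fix A assume "A \<in> carrier ?G"
      then obtain f where f: "A = path_class S f" "f \<in> loops_at S p"
        by (auto simp: carrier_fundamental_group)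
      then show "\<Psi> A \<in> carrier (free_group X)"
        using F.label_closed[OF loopD(1,2)[OF f(2)]] by (simp add: \<Psi>)
    next
      fix A B assume "A \<in> carrier ?G" "B \<in> carrier ?G"
      then obtain f g where fg: "A = path_class S f" "f \<in> loops_at S p" "B = path_class S g" "g \<in> loops_at S p"
        by (auto simp: carrier_fundamental_group)
      have "F.label (f +++ g) = F.label f \<otimes>\<^bsub>free_group X\<^esub> F.label g"
        using loopD[OF fg(2)] loopD[OF fg(4)] by (intro F.label_join) simp_all
      then show "\<Psi> (A \<otimes>\<^bsub>?G\<^esub> B) = \<Psi> A \<otimes>\<^bsub>free_group X\<^esub> \<Psi> B"
        using fg by (simp add: mult_path_class \<Psi> loops_at_join)
    qed
  next
    fix W assume W: "W \<in> X"
    define w where "w = (SOME x. x \<in> W)"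
    have w: "w \<in> U" "w \<in> V" "C w = W" "C w \<noteq> C p"
      using X_some[OF W] W by (auto simp: w_def X_def)
    have "\<epsilon> W = path_class S (c p +++ (d w +++ reversepath (c w)))"
      using W d[OF w(2)] by (simp add: \<epsilon>_def e_def \<tau>_def w_def)
    moreover have "c p +++ (d w +++ reversepath (c w)) \<in> loops_at S p"
      using \<tau>_loop[of "d w"] d_S[OF w(2)] by simp
    \<comment> \<open>Only the leg through \<open>V\<close> is seen by the label, because the other
      two legs lie in \<open>U\<close>.\<close>
    moreover have "F.label (c p +++ (d w +++ reversepath (c w))) = F.label (d w)"
    proof -
      have images: "path_image (c p) \<subseteq> U \<union> V" "path_image (d w) \<subseteq> U \<union> V"
        "path_image (reversepath (c w)) \<subseteq> U \<union> V"
        using cU(2)[of p] cU(2)[of w] d(2)[of w] p w by auto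
      have "F.label (c p) = []" "F.label (reversepath (c w)) = []"
        using cU[of p] cU[of w] p w F.label_in_U[of "c p"] F.label_in_U[of "reversepath (c w)"] by simp_all
      moreover have "F.label (d w) \<in> carrier (free_group X)"
        using d[OF w(2)] images by (intro F.label_closed)
      ultimately show ?thesis
        using images cU[of p] cU[of w] d[OF w(2)] p w F.l_one[of "F.label (d w)"] F.r_one[of "F.label (d w)"]
        by (simp add: F.label_join subset_path_image_join)
    qed
    moreover have "F.label (d w) = [(W, True)]"
    proof -
      have "F.label (d w) = inv\<^bsub>free_group X\<^esub> \<kappa> p \<otimes>\<^bsub>free_group X\<^esub> \<kappa> w"
        using F.label_in_V d[OF w(2)] by simp
      moreover have "\<kappa> p = \<one>\<^bsub>free_group X\<^esub>" "\<kappa> w = [(W, True)]"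
        using w by (simp_all add: \<kappa>_def)
      ultimately show ?thesis
        using F.\<kappa>_closed[of w] F.l_one[of "\<kappa> w"] F.inv_one by simp
    qed
    ultimately show "\<Psi> (\<epsilon> W) = [(W, True)]"
      using \<Psi> by simp
  next
    fix A assume "A \<in> carrier ?G"
    then obtain f where f: "A = path_class S f" "f \<in> loops_at S p"
      by (auto simp: carrier_fundamental_group)
    have fS: "path f" "path_image f \<subseteq> S" "pathstart f = p" "pathfinish f = p"
      using f by (simp_all add: loops_at_def)
    note [trans] = homotopic_paths_trans
    \<comment> \<open>The chosen path \<open>c p\<close> need not be constant, but it is a loop in
      \<open>U\<close> and hence contracts.\<close>
    have "homotopic_paths S (c p +++ (f +++ reversepath (c p))) (linepath p p +++ (f +++ linepath p p))"
    proof (intro homotopic_paths_join)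
      show "homotopic_paths S (c p) (linepath p p)" "homotopic_paths S (reversepath (c p)) (linepath p p)"
        using cU[of p] p
        by (intro homotopic_paths_subset[OF simply_connected_homotopic_paths[OF U(2)]]; simp add: S_def)+
    qed (use fS c[OF pS] in simp_all)
    also have "homotopic_paths S \<dots> (f +++ linepath p p)"
      using fS pS by (intro homotopic_paths_lid') (simp_all add: subset_path_image_join)
    also have "homotopic_paths S \<dots> f"
      using fS by (intro homotopic_paths_rid') simp_all
    finally have "\<tau> f = A"
      using fS f by (simp add: \<tau>_def path_class_eqI)
    then show "?ev (\<Psi> A) = A"
      using ev_label fS f \<Psi> by simp
  qed
  then show ?thesis
    unfolding S_def[symmetric] C_def[symmetric] X_def[symmetric] by (rule is_isoI)
qed


section \<open>Complements of lines\<close>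

text \<open>Moving along \<open>e\<close> raises \<open>h\<close> and fixes \<open>g\<close>, so a
  point of \<open>U\<close> never runs into a removed set. This pushes everything into a half-space
  above all the slits, which is convex.\<close>

lemma parallel_slits:
  fixes g h :: "'a::real_normed_vector \<Rightarrow> real"
  assumes lin: "bounded_linear g" "bounded_linear h" and e: "g e = 0" "h e = 1"
    and R: "finite R"
  defines "U \<equiv> {w. \<forall>(r, m)\<in>R. g w = r \<longrightarrow> m < h w}"
  shows "open U" and "simply_connected U"
proof -
  interpret g: bounded_linear g by fact
  interpret h: bounded_linear h by fact
  note [continuous_intros] = g.continuous_on h.continuous_on
  have "U = (\<Inter>z\<in>R. - ({w. g w = fst z} \<inter> {w. h w \<le> snd z}))"
    by (fastforce simp: U_def)
  then show "open U"
    using R by (auto intro!: open_INT closed_Collect_eq closed_Collect_le closed_Int continuous_intros)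
  have "bdd_above (snd ` R)"
    using R by simp
  then obtain B where "\<And>z. z \<in> R \<Longrightarrow> snd z \<le> B"
    by (auto simp: bdd_above_def)
  then obtain M where M: "\<And>z. z \<in> R \<Longrightarrow> snd z < M"
    by (meson gt_ex le_less_trans)
  define H where "H = {w. M \<le> h w}"
  have HU: "H \<subseteq> U"
    using M by (fastforce simp: H_def U_def)
  have H_convex: "convex H"
    using convex_linear_vimage[OF h.linear_axioms convex_real_interval(1)[of M]] by (simp add: H_def vimage_def)
  \<comment> \<open>The push is just long enough to reach height \<open>M\<close>, and it is zero
    for points already there.\<close>
  define r where "r w = w + max 0 (M - h w) *\<^sub>R e" for w
  have rH: "r w \<in> H" for w
    by (simp add: r_def H_def h.add h.scaleR e)
  have cont: "continuous_on U r"
    unfolding r_def by (intro continuous_intros)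
  have "homotopic_with_canon (\<lambda>_. True) U U (\<lambda>w. w) r"
  proof (rule homotopic_with_linear)
    fix w assume w: "w \<in> U"
    show "closed_segment w (r w) \<subseteq> U"
    proof
      fix z assume "z \<in> closed_segment w (r w)"
      then obtain u where u: "0 \<le> u" "u \<le> 1" "z = (1 - u) *\<^sub>R w + u *\<^sub>R r w"
        by (auto simp: in_segment)
      then have z: "z = w + (u * max 0 (M - h w)) *\<^sub>R e"
        by (simp add: r_def algebra_simps)
      have "g z = g w" "h w \<le> h z"
        using u(1) unfolding z by (simp_all add: g.add g.scaleR h.add h.scaleR e)
      then show "z \<in> U"
        using w by (fastforce simp: U_def)
    qed
  qed (use cont in \<open>auto intro!: continuous_intros\<close>)
  moreover have "closed_segment (r w) (r 0) \<subseteq> U" for w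
    using closed_segment_subset[OF rH rH H_convex] HU by blast
  then have "homotopic_with_canon (\<lambda>_. True) U U r (\<lambda>_. r 0)"
    using cont by (intro homotopic_with_linear) simp_all
  ultimately have "contractible U"
    unfolding contractible_def id_def by (blast intro: homotopic_with_trans)
  then show "simply_connected U"
    by (rule contractible_imp_simply_connected)
qed

text \<open>On the complex parametrization that joins \<open>p\<close> to \<open>q\<close>, some
  equation is satisfied at only finitely many parameters, and the parameter plane without these is
  path connected.\<close>

lemma path_connected_Compl_lines:
  fixes A :: "'i \<Rightarrow> complex \<times> complex \<times> complex"
  assumes "finite I"
  defines "S \<equiv> {(x, y). \<forall>i\<in>I. case A i of (a, b, c) \<Rightarrow> a * x + b * y + c \<noteq> 0}"
  shows "path_connected S"
  unfolding path_connected_def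
proof (intro ballI)
  fix p q assume p: "p \<in> S" and q: "q \<in> S"
  define l where "l i z = (case A i of (a, b, c) \<Rightarrow> a * fst z + b * snd z + c)" for i z
  have S: "z \<in> S \<longleftrightarrow> (\<forall>i\<in>I. l i z \<noteq> 0)" for z
    by (cases z) (auto simp: S_def l_def split: prod.splits)
  define \<gamma> where "\<gamma> t = (fst p + t * (fst q - fst p), snd p + t * (snd q - snd p))" for t
  have l\<gamma>: "l i (\<gamma> t) = l i p + t * (l i q - l i p)" for i t
    by (simp add: l_def \<gamma>_def algebra_simps split: prod.splits)
  define T where "T = (\<lambda>i. l i p / (l i p - l i q)) ` {i \<in> I. l i p \<noteq> l i q}"
  have "path_connected (- T)"
    using assms(1) by (intro path_connected_complement_countable) (auto simp: T_def intro: countable_finite)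
  moreover have "\<gamma> t \<in> S" if "t \<notin> T" for t
    unfolding S
  proof (intro ballI notI)
    fix i assume i: "i \<in> I" "l i (\<gamma> t) = 0"
    then have *: "l i p = t * (l i p - l i q)"
      by (simp add: l\<gamma> algebra_simps)
    moreover have "l i p \<noteq> 0"
      using p i S by blast
    ultimately have ne: "l i p - l i q \<noteq> 0"
      by auto
    with * have "t = l i p / (l i p - l i q)"
      by (simp add: nonzero_eq_divide_eq)
    with i that ne show False
      by (simp add: T_def)
  qed
  moreover have "0 \<notin> T" "1 \<notin> T"
  proof -
    show "0 \<notin> T"
      using p S by (auto simp: T_def)
    show "1 \<notin> T"
    proof
      assume "1 \<in> T"
      then obtain i where i: "i \<in> I" "l i p \<noteq> l i q" "1 = l i p / (l i p - l i q)"
        by (auto simp: T_def)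
      then have "l i q = 0"
        by (simp add: field_simps)
      with q S i(1) show False
        by blast
    qed
  qed
  ultimately obtain g where g: "path g" "path_image g \<subseteq> - T" "pathstart g = 0" "pathfinish g = 1"
    unfolding path_connected_def by blast
  have "continuous_on (path_image g) \<gamma>"
    unfolding \<gamma>_def by (intro continuous_intros)
  then have "path (\<gamma> \<circ> g)"
    using g by (simp add: path_continuous_image)
  moreover have "path_image (\<gamma> \<circ> g) \<subseteq> S"
    using g \<open>\<And>t. t \<notin> T \<Longrightarrow> \<gamma> t \<in> S\<close> by (auto simp: path_image_compose)
  moreover have "pathstart (\<gamma> \<circ> g) = p" "pathfinish (\<gamma> \<circ> g) = q"
    using g by (simp_all add: pathstart_compose pathfinish_compose \<gamma>_def)
  ultimately show "\<exists>g. path g \<and> path_image g \<subseteq> S \<and> pathstart g = p \<and> pathfinish g = q"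
    by blast
qed

text \<open>With \<open>l\<close> the equation of a line, this is the linking number with that line.
  It supplies the additive maps for \<open>free_group_commute_det\<close>.\<close>

lemma winding_number_hom:
  fixes S :: "'a::real_normed_vector set" and l :: "'a \<Rightarrow> complex"
  assumes l: "continuous_on S l" "0 \<notin> l ` S"
  obtains \<phi> :: "(real \<Rightarrow> 'a) set \<Rightarrow> complex"
    where "\<And>f. f \<in> loops_at S p \<Longrightarrow> \<phi> (path_class S f) = winding_number (l \<circ> f) 0"
      and "\<And>A B. A \<in> carrier (fundamental_group S p) \<Longrightarrow> B \<in> carrier (fundamental_group S p) \<Longrightarrow>
        \<phi> (A \<otimes>\<^bsub>fundamental_group S p\<^esub> B) = \<phi> A + \<phi> B"
proof
  define \<phi> where "\<phi> A = winding_number (l \<circ> (SOME f. f \<in> A)) 0" for A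
  show val: "\<phi> (path_class S f) = winding_number (l \<circ> f) 0" if "f \<in> loops_at S p" for f
  proof -
    have "homotopic_paths (- {0}) (l \<circ> f) (l \<circ> (SOME g. g \<in> path_class S f))"
      using l by (intro homotopic_paths_continuous_image[OF path_class_some[OF that]]) auto
    then show ?thesis
      by (simp add: \<phi>_def winding_number_homotopic_paths)
  qed
  fix A B assume "A \<in> carrier (fundamental_group S p)" "B \<in> carrier (fundamental_group S p)"
  then obtain f g where f: "A = path_class S f" "f \<in> loops_at S p" and g: "B = path_class S g" "g \<in> loops_at S p"
    by (auto simp: carrier_fundamental_group)
  have path: "path (l \<circ> k)" "0 \<notin> path_image (l \<circ> k)" if "k \<in> loops_at S p" for k
    using that l continuous_on_subset[OF l(1), of "path_image k"]
    by (auto simp: loops_at_def path_image_compose intro!: path_continuous_image)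
  have "winding_number (l \<circ> (f +++ g)) 0 = winding_number (l \<circ> f) 0 + winding_number (l \<circ> g) 0"
    unfolding path_compose_join using path f g
    by (intro winding_number_join) (auto simp: loops_at_def pathstart_compose pathfinish_compose)
  then show "\<phi> (A \<otimes>\<^bsub>fundamental_group S p\<^esub> B) = \<phi> A + \<phi> B"
    using f g by (simp add: mult_path_class val loops_at_join)
qed

text \<open>The two ways along the boundary of the square between opposite corners are homotopic,
  and by periodicity their images are \<open>u +++ v\<close> and \<open>v +++ u\<close>.\<close>

lemma torus_loops_commute:
  fixes T :: "real \<times> real \<Rightarrow> 'a::real_normed_vector"
  assumes T: "continuous_on ({0..1} \<times> {0..1}) T" "T ` ({0..1} \<times> {0..1}) \<subseteq> S"
    and per: "\<And>s. T (s, 1) = T (s, 0)" "\<And>t. T (1, t) = T (0, t)"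
  defines "u \<equiv> \<lambda>s. T (s, 0)" and "v \<equiv> \<lambda>t. T (0, t)"
  shows "u \<in> loops_at S (T (0, 0))" "v \<in> loops_at S (T (0, 0))"
    and "path_class S u \<otimes>\<^bsub>fundamental_group S (T (0, 0))\<^esub> path_class S v
       = path_class S v \<otimes>\<^bsub>fundamental_group S (T (0, 0))\<^esub> path_class S u"
proof -
  let ?Q = "{0..1} \<times> {0..1} :: (real \<times> real) set"
  have sub: "path_image (linepath a b) \<subseteq> ?Q" if "a \<in> ?Q" "b \<in> ?Q" for a b
    using that closed_segment_subset[of a ?Q b] by (simp add: convex_Times)
  have comp_u: "T \<circ> linepath (0, y) (1, y) = u" if "y = 0 \<or> y = 1" for y
    using that per by (auto simp: fun_eq_iff linepath_def u_def)
  have comp_v: "T \<circ> linepath (x, 0) (x, 1) = v" if "x = 0 \<or> x = 1" for x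
    using that per by (auto simp: fun_eq_iff linepath_def v_def)
  have path: "path (T \<circ> linepath a b)" "path_image (T \<circ> linepath a b) \<subseteq> S" if "a \<in> ?Q" "b \<in> ?Q" for a b
    using T sub[OF that] continuous_on_subset[OF T(1) sub[OF that]]
    by (auto simp: path_image_compose intro!: path_continuous_image)
  show u: "u \<in> loops_at S (T (0, 0))"
    using path[of "(0, 0)" "(1, 0)"] comp_u[of 0] per by (simp add: loops_at_def pathstart_def pathfinish_def u_def)
  show v: "v \<in> loops_at S (T (0, 0))"
    using path[of "(0, 0)" "(0, 1)"] comp_v[of 0] per by (simp add: loops_at_def pathstart_def pathfinish_def v_def)
  let ?f = "linepath (0, 0) (1, 0) +++ linepath (1, 0) (1, 1) :: real \<Rightarrow> real \<times> real"
  let ?g = "linepath (0, 0) (0, 1) +++ linepath (0, 1) (1, 1) :: real \<Rightarrow> real \<times> real"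
  have "simply_connected ?Q"
    by (simp add: convex_imp_simply_connected convex_Times)
  moreover have "path_image ?f \<subseteq> ?Q" "path_image ?g \<subseteq> ?Q"
    using sub by (simp_all add: path_image_join)
  ultimately have "homotopic_paths ?Q ?f ?g"
    by (simp add: simply_connected_eq_homotopic_paths)
  then have "homotopic_paths S (T \<circ> ?f) (T \<circ> ?g)"
    using T by (intro homotopic_paths_continuous_image) auto
  then have "homotopic_paths S (u +++ v) (v +++ u)"
    by (simp add: path_compose_join comp_u comp_v)
  then show "path_class S u \<otimes>\<^bsub>fundamental_group S (T (0, 0))\<^esub> path_class S v
       = path_class S v \<otimes>\<^bsub>fundamental_group S (T (0, 0))\<^esub> path_class S u"
    using u v by (simp add: mult_path_class path_class_eqI)
qed

text \<open>First \<open>\<delta>\<close> is chosen so that \<open>b * y + c\<close> has no zero on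
  the circle of radius \<open>\<delta>\<close>, then \<open>\<epsilon>\<close> so small that
  \<open>a * x\<close> cannot compensate. This fails only for \<open>b = 0\<close> and
  \<open>c = 0\<close>, where \<open>a * x\<close> is nonzero by itself.\<close>

lemma exists_torus_radii:
  fixes K :: "(complex \<times> complex \<times> complex) set"
  assumes "finite K" and K: "\<And>a b c. (a, b, c) \<in> K \<Longrightarrow> (a, b) \<noteq> (0, 0)"
  obtains \<epsilon> \<delta> :: real where "\<epsilon> > 0" "\<delta> > 0"
    "\<And>a b c x y. (a, b, c) \<in> K \<Longrightarrow> norm x = \<epsilon> \<Longrightarrow> norm y = \<delta> \<Longrightarrow> a * x + b * y + c \<noteq> 0"
proof -
  \<comment> \<open>For \<open>b = 0\<close> the excluded quotient is 0 by the convention for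
    division, so no positive radius is lost.\<close>
  have "infinite ({0<..} - (\<lambda>(a, b, c). norm c / norm b) ` K :: real set)"
    using assms(1) infinite_Ioi by (intro Diff_infinite_finite) auto
  then have "{0<..} - (\<lambda>(a, b, c). norm c / norm b) ` K \<noteq> {}"
    by (metis finite.emptyI)
  then obtain \<delta> where \<delta>: "\<delta> > 0" "\<delta> \<notin> (\<lambda>(a, b, c). norm c / norm b) ` K"
    by auto
  have "\<forall>k\<in>K. \<forall>\<^sub>F \<epsilon> in at_right 0. case k of (a, b, c) \<Rightarrow>
      b = 0 \<and> c = 0 \<or> norm a * \<epsilon> < \<bar>norm c - norm b * \<delta>\<bar>"
  proof
    fix k assume "k \<in> K"
    moreover obtain a b c where abc: "k = (a, b, c)"
      by (cases k)
    ultimately have k: "(a, b, c) \<in> K"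
      by simp
    show "\<forall>\<^sub>F \<epsilon> in at_right 0. case k of (a, b, c) \<Rightarrow>
        b = 0 \<and> c = 0 \<or> norm a * \<epsilon> < \<bar>norm c - norm b * \<delta>\<bar>"
    proof (cases "b = 0 \<and> c = 0")
      case False
      have "norm c - norm b * \<delta> \<noteq> 0"
      proof (cases "b = 0")
        case b: False
        have "\<delta> \<noteq> norm c / norm b"
          using \<delta>(2) k by force
        then show ?thesis
          using b by (simp add: field_simps)
      qed (use False in simp)
      moreover have "((\<lambda>\<epsilon>. norm a * \<epsilon>) \<longlongrightarrow> norm a * 0) (at_right 0)"
        by (intro tendsto_intros)
      ultimately have "\<forall>\<^sub>F \<epsilon> in at_right 0. norm a * \<epsilon> < \<bar>norm c - norm b * \<delta>\<bar>"
        by (intro order_tendstoD) auto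
      then show ?thesis
        by eventually_elim (simp add: abc)
    qed (simp add: abc)
  qed
  then have "\<forall>\<^sub>F \<epsilon> in at_right 0. \<forall>k\<in>K. case k of (a, b, c) \<Rightarrow>
      b = 0 \<and> c = 0 \<or> norm a * \<epsilon> < \<bar>norm c - norm b * \<delta>\<bar>"
    using assms(1) by (simp add: eventually_ball_finite)
  moreover have "\<forall>\<^sub>F \<epsilon> in at_right (0::real). \<epsilon> > 0"
    by (simp add: eventually_at_right_less)
  ultimately have "\<forall>\<^sub>F \<epsilon> in at_right 0. \<epsilon> > 0 \<and> (\<forall>k\<in>K. case k of (a, b, c) \<Rightarrow>
      b = 0 \<and> c = 0 \<or> norm a * \<epsilon> < \<bar>norm c - norm b * \<delta>\<bar>)"
    by eventually_elim simp
  from eventually_happens'[OF trivial_limit_at_right_real this]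
  obtain \<epsilon> where \<epsilon>: "\<epsilon> > 0" "\<And>a b c. (a, b, c) \<in> K \<Longrightarrow>
      b = 0 \<and> c = 0 \<or> norm a * \<epsilon> < \<bar>norm c - norm b * \<delta>\<bar>"
    by fastforce
  show ?thesis
  proof (rule that[OF \<epsilon>(1) \<delta>(1)])
    fix a b c x y :: complex
    assume k: "(a, b, c) \<in> K" and x: "norm x = \<epsilon>" and y: "norm y = \<delta>"
    show "a * x + b * y + c \<noteq> 0"
    proof (cases "b = 0 \<and> c = 0")
      case True
      then show ?thesis
        using K[OF k] x \<epsilon>(1) by auto
    next
      case False
      show ?thesis
      proof
        assume "a * x + b * y + c = 0"
        then have "a * x = - (c + b * y)"
          by (metis add.assoc add.commute eq_neg_iff_add_eq_0)
        then have "norm (a * x) = norm (c + b * y)"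
          by (simp only: norm_minus_cancel)
        then have "norm a * \<epsilon> = norm (c - (- (b * y)))"
          using x by (simp add: norm_mult)
        moreover have "\<bar>norm c - norm b * \<delta>\<bar> \<le> norm (c - (- (b * y)))"
          using norm_triangle_ineq3[of c "- (b * y)"] y by (simp add: norm_mult)
        ultimately show False
          using \<epsilon>(2)[OF k] False by simp
      qed
    qed
  qed
qed

section \<open>Parallel lines\<close>

lemma is_free_group_Un_simply_connected:
  fixes U V :: "'a::real_normed_vector set"
  assumes U: "open U" "simply_connected U" and V: "open V" "simply_connected V"
    and "U \<inter> V \<noteq> {}" and p: "p \<in> U \<union> V"
  shows "is_free_group (fundamental_group (U \<union> V) p)"
proof -
  obtain q where q: "q \<in> U \<inter> V"
    using assms by blast
  let ?G = "fundamental_group (U \<union> V) q"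
  obtain X :: "'a set set" where X: "?G \<cong> free_group X"
    using fundamental_group_Un_simply_connected[OF U V q] by blast
  \<comment> \<open>Components are sets of points, whereas a basis in the sense of
    \<open>is_free_group\<close> consists here of sets of functions. The encoding is injective
    because of the constant functions.\<close>
  have "inj_on (\<lambda>W. {f. f (0::real) \<in> W}) X"
    by (rule inj_onI) (auto simp: set_eq_iff dest: spec[of _ "\<lambda>_. _"])
  from free_group_map_iso[OF this] obtain Y :: "(real \<Rightarrow> 'a) set set" where "free_group X \<cong> free_group Y"
    by (blast intro: is_isoI)
  with X have "?G \<cong> free_group Y"
    by (rule iso_trans)
  moreover have "group ?G"
    using q by (intro group_fundamental_group) simp
  ultimately have "is_free_group ?G"
    by (auto simp: is_free_group_def)
  moreover have "path_connected (U \<union> V)"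
    using assms by (intro path_connected_Un simply_connected_imp_path_connected)
  ultimately show ?thesis
    using is_free_group_basepoint[of "U \<union> V" q p] q p by blast
qed

lemma exists_rotation_distinct_Re:
  fixes P :: "complex set"
  assumes "finite P"
  obtains \<mu> where "\<mu> \<noteq> 0" "inj_on (\<lambda>q. Re (\<mu> * q)) P"
proof -
  \<comment> \<open>Every \<open>t\<close> for which multiplication by \<open>Complex 1 t\<close>
    gives two distinct points of \<open>P\<close> the same real part lies in this set.\<close>
  let ?B = "(\<lambda>(q, r). Re (q - r) / Im (q - r)) ` (P \<times> P)"
  have "finite ?B"
    using assms by simp
  then obtain t where t: "t \<notin> ?B"
    using ex_new_if_finite[OF infinite_UNIV_char_0] by blast
  have "inj_on (\<lambda>q. Re (Complex 1 t * q)) P"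
  proof (rule inj_onI)
    fix q r assume qr: "q \<in> P" "r \<in> P" "Re (Complex 1 t * q) = Re (Complex 1 t * r)"
    then have *: "Re (q - r) = t * Im (q - r)"
      by (simp add: algebra_simps)
    show "q = r"
    proof (cases "Im (q - r) = 0")
      case True
      with * show ?thesis
        by (simp add: complex_eq_iff)
    next
      case False
      with * have "t = Re (q - r) / Im (q - r)"
        by (simp add: field_simps)
      with qr t show ?thesis
        by force
    qed
  qed
  then show ?thesis
    using that[of "Complex 1 t"] by (simp add: complex_eq_iff)
qed

lemma is_free_group_Compl_parallel_lines:
  fixes a b :: complex
  assumes ab: "(a, b) \<noteq> (0, 0)" and P: "finite P"
  defines "S \<equiv> {(x, y). a * x + b * y \<notin> P}"
  assumes p: "p \<in> S"
  shows "is_free_group (fundamental_group S p)"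
proof -
  obtain \<mu> where \<mu>: "\<mu> \<noteq> 0" "inj_on (\<lambda>q. Re (\<mu> * q)) P"
    using exists_rotation_distinct_Re[OF P] .
  define f where "f w = \<mu> * (a * fst w + b * snd w)" for w
  have lin: "bounded_linear f"
    unfolding f_def
    by (intro bounded_linear_const_mult bounded_linear_add bounded_linear_fst bounded_linear_snd)
  have Re: "bounded_linear (\<lambda>w. Re (f w))" and Im: "bounded_linear (\<lambda>w. Im (f w))"
    using lin by (auto intro: bounded_linear_compose[OF bounded_linear_Re] bounded_linear_compose[OF bounded_linear_Im])
  have surj: "\<exists>w. f w = z" for z
  proof (cases "a = 0")
    case True
    then have "f (0, z / (\<mu> * b)) = z"
      using ab \<mu> by (simp add: f_def)
    then show ?thesis ..
  next
    case False
    then have "f (z / (\<mu> * a), 0) = z"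
      using \<mu> by (simp add: f_def)
    then show ?thesis ..
  qed
  then obtain e where e: "f e = \<i>"
    by blast
  define U where "U = {w. \<forall>(r, m)\<in>(\<lambda>q. (Re (\<mu> * q), Im (\<mu> * q))) ` P. Re (f w) = r \<longrightarrow> m < Im (f w)}"
  \<comment> \<open>The same shape upside down, so that \<open>parallel_slits\<close> applies with
    the negated imaginary part and with \<open>- e\<close>.\<close>
  define V where "V = {w. \<forall>(r, m)\<in>(\<lambda>q. (Re (\<mu> * q), - Im (\<mu> * q))) ` P. Re (f w) = r \<longrightarrow> m < - Im (f w)}"
  have "open U" "simply_connected U"
    unfolding U_def by (rule parallel_slits[OF Re Im, of e]; use P e in simp)+
  moreover have me: "f (- e) = - \<i>"
    using e lin by (simp add: linear_neg bounded_linear.linear)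
  have "open V" "simply_connected V"
    unfolding V_def by (rule parallel_slits[OF Re bounded_linear_minus[OF Im], of "- e"]; use P me in simp)+
  \<comment> \<open>If \<open>w\<close> is in neither set, then \<open>f w\<close> is at or below
    one rotated point of \<open>P\<close> and at or above another with the same real part. Distinct
    real parts make these two equal, so \<open>f w\<close> hits a removed value.\<close>
  moreover have "S = U \<union> V"
  proof (intro equalityI subsetI)
    fix w assume w: "w \<in> S"
    have Im_ne: "Im (f w) \<noteq> Im (\<mu> * q)" if "q \<in> P" "Re (f w) = Re (\<mu> * q)" for q
    proof
      assume "Im (f w) = Im (\<mu> * q)"
      with that have "f w = \<mu> * q"
        by (simp add: complex_eq_iff)
      then show False
        using w that \<mu> by (auto simp: f_def S_def)
    qed
    show "w \<in> U \<union> V"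
    proof (rule ccontr)
      assume "w \<notin> U \<union> V"
      then obtain q r where q: "q \<in> P" "Re (f w) = Re (\<mu> * q)" "Im (f w) \<le> Im (\<mu> * q)"
        and r: "r \<in> P" "Re (f w) = Re (\<mu> * r)" "Im (f w) \<ge> Im (\<mu> * r)"
        unfolding U_def V_def by (auto simp del: times_complex.sel)
      then have "q = r"
        using \<mu>(2) by (auto dest: inj_onD simp del: times_complex.sel)
      then show False
        using q(3) r(3) Im_ne[OF q(1,2)] by (simp del: times_complex.sel)
    qed
  next
    fix w assume "w \<in> U \<union> V"
    moreover have "f w = \<mu> * (a * fst w + b * snd w)"
      by (simp add: f_def)
    ultimately show "w \<in> S"
      by (cases w) (auto simp: U_def V_def S_def simp del: times_complex.sel)
  qed
  moreover have "U \<inter> V \<noteq> {}"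
  proof -
    have "finite ((\<lambda>q. Re (\<mu> * q)) ` P)"
      using P by simp
    \<comment> \<open>Over a vertical line that passes through none of the rotated points, the
      conditions for \<open>U\<close> and \<open>V\<close> are both vacuous.\<close>
    then obtain t where t: "t \<notin> (\<lambda>q. Re (\<mu> * q)) ` P"
      using ex_new_if_finite[OF infinite_UNIV_char_0] by blast
    obtain w where "f w = of_real t"
      using surj by blast
    with t have "w \<in> U \<inter> V"
      by (auto simp: U_def V_def simp del: times_complex.sel)
    then show ?thesis
      by blast
  qed
  ultimately show ?thesis
    using is_free_group_Un_simply_connected[of U V p] p by simp
qed

section \<open>Crossing lines\<close>

lemma not_free_group_Compl_crossing_lines:
  fixes a b c :: "'i \<Rightarrow> complex"
  assumes I: "finite I" and ab: "\<And>k. k \<in> I \<Longrightarrow> (a k, b k) \<noteq> (0, 0)"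
    and i: "i \<in> I" and j: "j \<in> I" and cross: "a i * b j \<noteq> a j * b i"
  defines "S \<equiv> {(x, y). \<forall>k\<in>I. a k * x + b k * y + c k \<noteq> 0}"
  assumes p: "p \<in> S"
  shows "\<not> is_free_group (fundamental_group S p)"
proof
  assume free: "is_free_group (fundamental_group S p)"
  define D where "D = a i * b j - a j * b i"
  have D: "D \<noteq> 0"
    using cross by (simp add: D_def)
  define l where "l k z = a k * fst z + b k * snd z + c k" for k z
  have S: "z \<in> S \<longleftrightarrow> (\<forall>k\<in>I. l k z \<noteq> 0)" for z
    by (cases z) (simp add: S_def l_def)
  \<comment> \<open>The crossing point of the lines \<open>i\<close> and \<open>j\<close>, by
    Cramer's rule. \<open>Q\<close> is the affine chart centred there in which the equations of
    these lines are the two coordinates; \<open>\<alpha> k\<close> and \<open>\<beta> k\<close> are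
    the coefficients of \<open>l k\<close> in it.\<close>
  define Z where "Z = ((b i * c j - b j * c i) / D, (c i * a j - c j * a i) / D)"
  define Q where "Q x y = (fst Z + (x * b j - y * b i) / D, snd Z + (y * a i - x * a j) / D)" for x y
  define \<alpha> where "\<alpha> k = (a k * b j - a j * b k) / D" for k
  define \<beta> where "\<beta> k = (a i * b k - a k * b i) / D" for k
  have lQ: "l k (Q x y) = \<alpha> k * x + \<beta> k * y + l k Z" for k x y
    using D by (simp add: l_def Q_def \<alpha>_def \<beta>_def field_simps)
  have ij: "\<alpha> i = 1" "\<beta> i = 0" "l i Z = 0" "\<alpha> j = 0" "\<beta> j = 1" "l j Z = 0"
    using D by (simp_all add: \<alpha>_def \<beta>_def l_def Z_def field_simps) (simp_all add: D_def algebra_simps)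
  have \<alpha>\<beta>: "(\<alpha> k, \<beta> k) \<noteq> (0, 0)" if "k \<in> I" for k
  proof
    assume "(\<alpha> k, \<beta> k) = (0, 0)"
    then have *: "a k * b j = a j * b k" "a i * b k = a k * b i"
      using D by (simp_all add: \<alpha>_def \<beta>_def)
    have "a k * D = 0" "b k * D = 0"
      using * unfolding D_def by algebra+
    then show False
      using D ab[OF that] by simp
  qed
  \<comment> \<open>More than two lines may meet at \<open>Z\<close>; their constant terms are 0,
    and the torus avoids them by the choice of its radii.\<close>
  define K where "K = (\<lambda>k. (\<alpha> k, \<beta> k, l k Z)) ` I"
  have K_props: "finite K" "\<And>x y z. (x, y, z) \<in> K \<Longrightarrow> (x, y) \<noteq> (0, 0)"
    using I \<alpha>\<beta> by (auto simp: K_def)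
  obtain \<epsilon> \<delta> :: real where pos: "\<epsilon> > 0" "\<delta> > 0"
    and K: "\<And>a' b' c' x y. (a', b', c') \<in> K \<Longrightarrow> norm x = \<epsilon> \<Longrightarrow> norm y = \<delta> \<Longrightarrow> a' * x + b' * y + c' \<noteq> 0"
    by (rule exists_torus_radii[of K, OF K_props]) (assumption, rule that)
  have QS: "Q x y \<in> S" if "norm x = \<epsilon>" "norm y = \<delta>" for x y
    using K[OF _ that] by (auto simp: S lQ K_def)
  define T where "T z = Q (circlepath 0 \<epsilon> (fst z)) (circlepath 0 \<delta> (snd z))" for z :: "real \<times> real"
  have norm_circle: "norm (circlepath 0 r s) = \<bar>r\<bar>" for r s
    by (simp add: circlepath norm_mult norm_exp_eq_Re)
  have per: "circlepath 0 r 1 = circlepath 0 r 0" "circlepath 0 r 0 = of_real r" for r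
    by (simp_all add: circlepath)
  let ?u = "\<lambda>s. T (s, 0)" and ?v = "\<lambda>t. T (0, t)"
  have "continuous_on ({0..1} \<times> {0..1}) T"
    unfolding T_def Q_def circlepath by (intro continuous_intros) (use D in auto)
  moreover have TS: "T z \<in> S" for z
    unfolding T_def using pos by (intro QS) (simp_all add: norm_circle)
  then have "T ` ({0..1} \<times> {0..1}) \<subseteq> S"
    by blast
  moreover have "T (s, 1) = T (s, 0)" "T (1, t) = T (0, t)" for s t
    by (simp_all add: T_def per)
  ultimately have loops: "?u \<in> loops_at S (T (0, 0))"
      "?v \<in> loops_at S (T (0, 0))"
    and comm: "path_class S ?u \<otimes>\<^bsub>fundamental_group S (T (0, 0))\<^esub> path_class S ?v
      = path_class S ?v \<otimes>\<^bsub>fundamental_group S (T (0, 0))\<^esub> path_class S ?u"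
    by (rule torus_loops_commute)+
  have cont: "continuous_on S (l k)" for k
    unfolding l_def by (intro continuous_intros)
  have nz: "0 \<notin> l i ` S" "0 \<notin> l j ` S"
    using i j S by (metis imageE)+
  obtain \<phi> where \<phi>: "\<And>f. f \<in> loops_at S (T (0, 0)) \<Longrightarrow> \<phi> (path_class S f) = winding_number (l i \<circ> f) 0"
    "\<And>A B. A \<in> carrier (fundamental_group S (T (0, 0))) \<Longrightarrow> B \<in> carrier (fundamental_group S (T (0, 0))) \<Longrightarrow>
        \<phi> (A \<otimes>\<^bsub>fundamental_group S (T (0, 0))\<^esub> B) = \<phi> A + \<phi> B"
    by (rule winding_number_hom[OF cont nz(1), of "T (0, 0)"]) (rule that)
  obtain \<psi> where \<psi>: "\<And>f. f \<in> loops_at S (T (0, 0)) \<Longrightarrow> \<psi> (path_class S f) = winding_number (l j \<circ> f) 0"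
    "\<And>A B. A \<in> carrier (fundamental_group S (T (0, 0))) \<Longrightarrow> B \<in> carrier (fundamental_group S (T (0, 0))) \<Longrightarrow>
        \<psi> (A \<otimes>\<^bsub>fundamental_group S (T (0, 0))\<^esub> B) = \<psi> A + \<psi> B"
    by (rule winding_number_hom[OF cont nz(2), of "T (0, 0)"]) (rule that)
  have "l i \<circ> ?u = circlepath 0 \<epsilon>" "l j \<circ> ?v = circlepath 0 \<delta>"
    by (simp_all add: fun_eq_iff T_def lQ ij)
  then have w1: "winding_number (l i \<circ> ?u) 0 = 1" "winding_number (l j \<circ> ?v) 0 = 1"
    using pos by (simp_all add: winding_number_circlepath_centre)
  \<comment> \<open>In the chart \<open>l i\<close> is the first coordinate, which rests at
    \<open>\<epsilon>\<close> along \<open>?v\<close>.\<close>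
  have w0: "winding_number (l i \<circ> ?v) 0 = 0"
    using pos by (intro winding_number_constI[of "of_real \<epsilon>"]) (simp_all add: T_def lQ ij per)
  have w0': "winding_number (l j \<circ> ?u) 0 = 0"
    using pos by (intro winding_number_constI[of "of_real \<delta>"]) (simp_all add: T_def lQ ij per)
  have "T (0, 0) \<in> S"
    by (rule TS)
  moreover have "path_connected S"
    using path_connected_Compl_lines[OF I, of "\<lambda>k. (a k, b k, c k)"] by (simp add: S_def)
  ultimately have "is_free_group (fundamental_group S (T (0, 0)))"
    using is_free_group_basepoint[of S p "T (0, 0)"] p free by blast
  moreover have "path_class S ?u \<in> carrier (fundamental_group S (T (0, 0)))"
    "path_class S ?v \<in> carrier (fundamental_group S (T (0, 0)))"
    using loops by (simp_all add: carrier_fundamental_group)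
  ultimately have "\<phi> (path_class S ?u) * \<psi> (path_class S ?v) = \<phi> (path_class S ?v) * \<psi> (path_class S ?u)"
    using comm \<phi>(2) \<psi>(2) by (rule free_group_commute_det)
  then show False
    using loops by (simp add: \<phi>(1) \<psi>(1) w0 w0' w1)
qed

lemma proportional_pairs:
  fixes a b a' b' :: "'a::field"
  assumes "(a, b) \<noteq> (0, 0)" "(a', b') \<noteq> (0, 0)" "a * b' = a' * b"
  obtains k where "k \<noteq> 0" "a' = k * a" "b' = k * b"
proof (cases "a = 0")
  case True
  with assms show ?thesis
    by (intro that[of "b' / b"]) auto
next
  case False
  with assms show ?thesis
    by (intro that[of "a' / a"]) (auto simp: field_simps)
qed

theorem corollary1:
  fixes n :: nat
    and L :: "nat \<Rightarrow> (complex \<times> complex) set"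
    and \<Sigma> :: "(complex \<times> complex) set"
    and p :: "complex \<times> complex"
  assumes "n \<ge> 2"
    and "\<And>i. i \<in> {1..n} \<Longrightarrow> complex_line (L i)"
    and "inj_on L {1..n}"
    and "\<Sigma> = (\<Union>i\<in>{1..n}. L i)"
    and "p \<in> UNIV - \<Sigma>"
  shows "parallel_lines {1..n} L \<longleftrightarrow> is_free_group (fundamental_group (UNIV - \<Sigma>) p)"
proof -
  have "\<forall>i\<in>{1..n}. \<exists>z. case z of (a, b, c) \<Rightarrow> (a, b) \<noteq> (0, 0) \<and> L i = {(x, y). a * x + b * y + c = 0}"
    using assms(2) unfolding complex_line_def by fastforce
  then obtain A where A: "\<forall>i\<in>{1..n}. case A i of (a, b, c) \<Rightarrow>
      (a, b) \<noteq> (0, 0) \<and> L i = {(x, y). a * x + b * y + c = 0}"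
    by (rule bchoice[THEN exE])
  define a b c where "a i = fst (A i)" and "b i = fst (snd (A i))" and "c i = snd (snd (A i))" for i
  have ab: "(a i, b i) \<noteq> (0, 0)" and L: "L i = {(x, y). a i * x + b i * y + c i = 0}" if "i \<in> {1..n}" for i
    using bspec[OF A that] by (simp_all add: a_def b_def c_def case_prod_unfold)
  have dir: "direction (L i) = {(x, y). a i * x + b i * y = 0}" if "i \<in> {1..n}" for i
    using direction_line[OF ab[OF that]] L[OF that] by simp
  show ?thesis
  proof
    assume par: "parallel_lines {1..n} L"
    have 1: "1 \<in> {1..n}"
      using assms(1) by simp
    have "\<exists>q. L i = {(x, y). a 1 * x + b 1 * y = q}" if i: "i \<in> {1..n}" for i
    proof -
      \<comment> \<open>This vector spans the direction of the first line; that it lies in the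
        direction of another line says that the determinant of the two equations vanishes.\<close>
      have "(b 1, - a 1) \<in> direction (L 1)"
        using dir[OF 1] by simp
      moreover have "direction (L 1) = direction (L i)"
        using par i 1 unfolding parallel_lines_def by blast
      ultimately have "(b 1, - a 1) \<in> direction (L i)"
        by simp
      then have "a 1 * b i = a i * b 1"
        using dir[OF i] by (simp add: algebra_simps)
      then obtain k where k: "k \<noteq> 0" "a i = k * a 1" "b i = k * b 1"
        using proportional_pairs[OF ab[OF 1] ab[OF i]] by metis
      have "a i * x + b i * y + c i = 0 \<longleftrightarrow> a 1 * x + b 1 * y = - c i / k" for x y
      proof -
        have "a i * x + b i * y + c i = k * (a 1 * x + b 1 * y) + c i"
          using k by (simp add: algebra_simps)
        then show ?thesis
          unfolding nonzero_eq_divide_eq[OF k(1)] eq_neg_iff_add_eq_0 by (simp add: mult.commute)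
      qed
      then show ?thesis
        using L[OF i] by auto
    qed
    then obtain q where q: "\<And>i. i \<in> {1..n} \<Longrightarrow> L i = {(x, y). a 1 * x + b 1 * y = q i}"
      by metis
    have "UNIV - \<Sigma> = {(x, y). a 1 * x + b 1 * y \<notin> q ` {1..n}}"
      unfolding assms(4) using q by auto
    then show "is_free_group (fundamental_group (UNIV - \<Sigma>) p)"
      using is_free_group_Compl_parallel_lines[OF ab[OF 1], of "q ` {1..n}" p] assms(5) by simp
  next
    assume free: "is_free_group (fundamental_group (UNIV - \<Sigma>) p)"
    have S: "UNIV - \<Sigma> = {(x, y). \<forall>k\<in>{1..n}. a k * x + b k * y + c k \<noteq> 0}"
      unfolding assms(4) using L by auto
    show "parallel_lines {1..n} L"
      unfolding parallel_lines_def
    proof (intro ballI)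
      fix i j assume i: "i \<in> {1..n}" and j: "j \<in> {1..n}"
      have "a i * b j = a j * b i"
        using not_free_group_Compl_crossing_lines[of "{1..n}" a b i j p c] ab i j free assms(5)
        unfolding S by blast
      then obtain k where k: "k \<noteq> 0" "a j = k * a i" "b j = k * b i"
        using proportional_pairs[OF ab[OF i] ab[OF j]] by metis
      have "a j * x + b j * y = k * (a i * x + b i * y)" for x y
        using k by (simp add: algebra_simps)
      then show "direction (L i) = direction (L j)"
        using k(1) dir[OF i] dir[OF j] by simp
    qed
  qed
qed

end
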